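(* Let $0\le k<d$, let $\mathcal{T}$ be a 2:1 $k$-balanced forest-of-trees mesh distributed among $P$ processors with $k$-ghost cells, and let $\mathcal{V}_h$ be a conforming finite element space on $\mathcal{T}$. If $\max(1,D(\mathcal{V}_h))\ge k$, then all hanging DOF constraints are direct, i.e., they only depend on regular DOFs (DOFs that are not owned by hanging VEFs). Furthermore, for every processor $p$, all constraints of DOFs owned by $n$-faces in $\mathcal{F}_H\cap\mathcal{F}_L^p$ only depend on DOFs owned by $\mathcal{F}_R\cap\mathcal{F}_L^p$, and thus can be solved in parallel with processor-local information.
   Context: **Polytopes, cells, VEFs.** $\Omega\subset\mathbb{R}^d$ is open and bounded. The boundary of a (open) polytope is partitioned into disjoint lower-dimensional open polytopes, its $n$-faces ($0\le n<d$ is the dimension); the $n$-faces on the boundary of an $m$-face ($n<m$) of a polytope are also $n$-faces of the polytope. A VEF is any $n$-face with $0\le n<d$. A cell $K$ is the image of a reference polytope under a differentiable homeomorphism; $\mathcal{F}_K$ is the set of its local VEFs (images of the VEFs of the reference polytope). A local VEF $f$ is a pair (cell, geometrical domain); $[f]$ denotes its geometrical domain (global VEF), and $[\mathcal{F}_K]=\{[f]:f\in\mathcal{F}_K\}$. A mesh is conforming if for any two distinct cells $K,K'$ with $\overline{K}\cap\overline{K'}\ne\emptyset$ there are $f\in\mathcal{F}_K$, $f'\in\mathcal{F}_{K'}$ with $[\overline f]=[\overline{f'}]=\overline K\cap\overline{K'}$. Throughout, $\subset$ allows equality. **Forest-of-trees.** $\mathcal{C}$ is a conforming (coarse) mesh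 of $\Omega$. A refinement rule replaces a parent cell $K$ by its children, which form a conforming mesh $\mathcal{R}_K$ of $K$ (with an orientation of its $n$-faces); its restriction to any $n$-face of $K$ with $n>0$ is a non-trivial partition of that $n$-face. Recursive application of the rule gives non-degenerate meshes (there is $\rho>0$ independent of the number of levels such that every cell $K$ contains a ball of diameter $\rho\,\mathrm{diam}(K)$). It is also assumed that for every $\ell$ the mesh of all leaves obtained after $\ell$ uniform refinements of $\mathcal{C}$ is conforming. Recursively refining (and coarsening) selected cells starting from $\mathcal{C}$ yields a forest of refinement trees, one rooted at each cell of $\mathcal{C}$; the forest-of-trees mesh $\mathcal{T}$ is the set of all leaf cells. $\ell(K)$ is the refinement level of $K$ ($0$ for cells of $\mathcal{C}$). $\mathcal{F}=\bigcup_{K\in\mathcal{T}}[\mathcal{F}_K]$ is the set of global VEFs. **Neighbors and balance.** $K'\in\mathcal{T}\setminus\{K\}$ is a neighbor of $K\in\mathcal{T}$ across $f\in\mathcal{F}_K$ (or across $F=[f]$) if there is $f'\in\mathcal{F}_{K'}$ such that $[f]=[f']$, or $[f]\supsetneq[f']$, or $[f]\subsetneq[f']$, and moreover $[\overline f]\cap[\overline{f'}]=\overline K\cap\overline{K'}$. $\mathcal{T}$ is 2:1 $k$-balanced if for any $K\in\mathcal{T}$ and any $n$-face $F\in[\mathcal{F}_K]$ with $k\le n<d$ there is no neighbor $K'$ of $K$ across $F$ with $|\ell(K')-\ell(K)|>1$. **Regular/hanging VEFs and owners.** For $F\in\mathcal{F}$: $\mathcal{T}_F=\{K\in\mathcal{T}:F\in[\mathcal{F}_K]\}$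 and $\tilde{\mathcal{T}}_F=\{K\in\mathcal{T}:F\notin[\mathcal{F}_K],\ F\subset\overline K\}$. $F$ is regular if $\tilde{\mathcal{T}}_F=\emptyset$ and hanging otherwise; $\mathcal{F}_R,\mathcal{F}_H$ are the sets of regular and hanging VEFs. For a VEF $f$ of a child of a cell $K_p$, its owner $O_f$ is the unique element of $\mathcal{F}_{K_p}\cup\{K_p\}$ that contains $f$. For $F\in\mathcal{F}_H$, its owner VEF is $O_F=[O_f]$, where $f\in\mathcal{F}_K$ is a local VEF with $[f]=F$ of a cell $K\in\mathcal{T}$ and $O_f$ is taken with respect to the parent $K_p$ of $K$. **Distributed mesh.** Each cell of $\mathcal{T}$ is owned by exactly one processor $p\in\{1,\dots,P\}$; $\mathcal{T}_L^p$ is the set of cells owned by $p$ (local cells). With $s$-ghost cells ($0\le s<d$; here $s=k$), $\mathcal{T}_G^p$ is the set of all cells in $\mathcal{T}\setminus\mathcal{T}_L^p$ that are neighbors of cells in $\mathcal{T}_L^p$ across $n$-faces with $n\ge s$. Processor $p$ stores $\mathcal{T}^p=\mathcal{T}_L^p\cup\mathcal{T}_G^p$, and $\mathcal{F}^p=\bigcup_{K\in\mathcal{T}^p}[\mathcal{F}_K]$. Put $\mathcal{T}_F^p=\mathcal{T}_F\cap\mathcal{T}^p$, $\tilde{\mathcal{T}}_F^p=\tilde{\mathcal{T}}_F\cap\mathcal{T}^p$. A VEF $F\in\mathcal{F}^p$ is in $\mathcal{F}_L^p$ iff one of the following holds: (a) $\mathcal{T}_F^p\cap\mathcal{T}_L^p\neq\emptyset$;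 (b) all cells in $\mathcal{T}_F^p$ are ghost but $\tilde{\mathcal{T}}_F^p\cap\mathcal{T}_L^p\ne\emptyset$; (c) all cells in $\mathcal{T}_F^p$ are ghost and $F=O_{F'}$ for some $F'\in\mathcal{F}_L^p$; (d) all cells in $\mathcal{T}_F^p$ are ghost and $F$ lies at the boundary of a VEF that fulfills (c). **DOFs and constraints.** On each cell there is a local finite element space with a unisolvent set of local degrees of freedom (DOFs), each owned by a VEF of the cell or by the cell itself; local DOFs are glued into global DOFs, each owned by a global VEF or a cell, such that continuity of global DOF values gives the trace continuity required for conformity across conforming interfaces. $D(\mathcal{V}_h)$ is the dimension of the $n$-face of lowest dimension that has a non-empty set of owned DOFs (e.g. $0$ for Lagrangian, $1$ for edge, $2$ for face elements, $d$ for discontinuous Galerkin). Hanging DOFs are those owned by hanging VEFs. To enforce conformity across cells of different level, each DOF owned by a hanging VEF $F$ is constrained to be a linear combination of DOFs owned by $O_F$ and by the VEFs on the boundary of $O_F$; the constraint "depends on" these DOFs. "Processor-local information" of $p$ is the information on the cells of $\mathcal{T}^p$ and their VEFs.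
   Formalization: Ghost cells are taken symmetrically (the n-face may belong to the local or the ghost cell; otherwise false for red-refined triangles); each closed child meets a closed face of its parent in a closed face or not at all; cell maps have differentiable inverses. *)

theory Defs
  imports "HOL-Analysis.Analysis"
begin

section \<open>Cells, faces and meshes\<close>

text \<open>
  The ambient dimension $d$ is \<open>DIM('a)\<close>.  A cell is given by a closed, full-dimensional
  reference polytope and a map that is a differentiable homeomorphism, with differentiable inverse,
  from that closed polytope onto the closure of the cell.  Open faces of a polytope are the relative
  interiors of the closed faces of the library (\<^const>\<open>face_of\<close>).

  A local VEF of \<open>K\<close> is a pair \<open>(K, F)\<close> with geometrical domain \<open>F \<in> vefs K\<close>, so quantifying over
  the local VEFs of a given \<open>K\<close> is the same as quantifying over \<open>vefs K\<close>.
\<close>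

record 'a cell =
  ref_polytope :: "'a set"
  cell_map :: "'a \<Rightarrow> 'a"

definition is_cell :: "'a::euclidean_space cell \<Rightarrow> bool" where
  "is_cell K \<longleftrightarrow>
     polytope (ref_polytope K) \<and> aff_dim (ref_polytope K) = int DIM('a) \<and>
     (\<exists>\<Psi>. homeomorphism (ref_polytope K) (cell_map K ` ref_polytope K) (cell_map K) \<Psi> \<and>
          cell_map K differentiable_on ref_polytope K \<and>
          \<Psi> differentiable_on (cell_map K ` ref_polytope K))"

definition cell_dom :: "'a::euclidean_space cell \<Rightarrow> 'a set" where
  "cell_dom K = cell_map K ` interior (ref_polytope K)"

text \<open>For \<open>n = d\<close> the only \<open>n\<close>-face is \<open>cell_dom K\<close> itself; it is not a VEF.\<close>

definition n_faces :: "nat \<Rightarrow> 'a::euclidean_space cell \<Rightarrow> 'a set set" where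
  "n_faces n K =
     {cell_map K ` rel_interior g | g. g face_of ref_polytope K \<and> aff_dim g = int n}"

definition vefs :: "'a::euclidean_space cell \<Rightarrow> 'a set set" where
  "vefs K = (\<Union>n<DIM('a). n_faces n K)"

definition boundary_vefs :: "'a::euclidean_space cell \<Rightarrow> 'a set \<Rightarrow> 'a set set" where
  "boundary_vefs K F = {W \<in> vefs K. W \<subseteq> closure F - F}"

definition mesh_of :: "'a::euclidean_space set \<Rightarrow> 'a cell set \<Rightarrow> bool" where
  "mesh_of S M \<longleftrightarrow>
     finite M \<and> (\<forall>K\<in>M. is_cell K \<and> cell_dom K \<subseteq> S) \<and>
     pairwise (\<lambda>K K'. disjnt (cell_dom K) (cell_dom K')) M \<and>
     (\<Union>K\<in>M. closure (cell_dom K)) = closure S"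

definition conforming :: "'a::euclidean_space cell set \<Rightarrow> bool" where
  "conforming M \<longleftrightarrow>
     (\<forall>K\<in>M. \<forall>K'\<in>M. K \<noteq> K' \<longrightarrow> closure (cell_dom K) \<inter> closure (cell_dom K') \<noteq> {} \<longrightarrow>
        (\<exists>F\<in>vefs K. \<exists>F'\<in>vefs K'. closure F = closure F' \<and>
            closure F = closure (cell_dom K) \<inter> closure (cell_dom K')))"


section \<open>Forest-of-trees meshes\<close>

text \<open>
  The restriction of a mesh \<open>M\<close> to an \<open>n\<close>-face \<open>G\<close> of the parent consists of the \<open>n\<close>-faces of cells
  of \<open>M\<close> that lie in \<open>G\<close>.  The first conjunct says that the closed cells cut the closed face in
  closed faces; for cells that are convex in the reference space of the parent this is automatic.
  A cell may meet the closed face in a face of dimension less than \<open>n\<close>, as the central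
  child in the red refinement of a triangle does.
\<close>

definition restriction :: "'a::euclidean_space cell set \<Rightarrow> nat \<Rightarrow> 'a set \<Rightarrow> 'a set set" where
  "restriction M n G = {g. g \<subseteq> G \<and> (\<exists>K\<in>M. g \<in> n_faces n K)}"

definition nontrivial_face_partition ::
    "'a::euclidean_space cell set \<Rightarrow> nat \<Rightarrow> 'a set \<Rightarrow> bool" where
  "nontrivial_face_partition M n G \<longleftrightarrow>
     (\<forall>K\<in>M. closure (cell_dom K) \<inter> closure G = {} \<or>
        (\<exists>m. \<exists>g\<in>n_faces m K. closure (cell_dom K) \<inter> closure G = closure g)) \<and>
     pairwise disjnt (restriction M n G) \<and>
     (\<Union>g\<in>restriction M n G. closure g) = closure G \<and>
     restriction M n G \<noteq> {G}"

definition refinement_of :: "'a::euclidean_space cell \<Rightarrow> 'a cell set \<Rightarrow> bool" where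
  "refinement_of K M \<longleftrightarrow>
     mesh_of (cell_dom K) M \<and> conforming M \<and>
     (\<forall>n\<in>{1..DIM('a)}. \<forall>G\<in>n_faces n K. nontrivial_face_partition M n G)"

text \<open>A refinement rule \<open>R\<close> maps a cell to the set of its children; \<open>C\<close> is the coarse mesh.\<close>

primrec uniform_mesh :: "('a cell \<Rightarrow> 'a cell set) \<Rightarrow> 'a cell set \<Rightarrow> nat \<Rightarrow> 'a cell set" where
  "uniform_mesh R C 0 = C"
| "uniform_mesh R C (Suc l) = (\<Union>K\<in>uniform_mesh R C l. R K)"

definition tree_cells :: "('a cell \<Rightarrow> 'a cell set) \<Rightarrow> 'a cell set \<Rightarrow> 'a cell set" where
  "tree_cells R C = (\<Union>l. uniform_mesh R C l)"

text \<open>The level is unique, since refinements are non-trivial.\<close>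

definition level :: "('a cell \<Rightarrow> 'a cell set) \<Rightarrow> 'a cell set \<Rightarrow> 'a cell \<Rightarrow> nat" where
  "level R C K = (LEAST l. K \<in> uniform_mesh R C l)"

definition forest_setting ::
    "'a::euclidean_space set \<Rightarrow> ('a cell \<Rightarrow> 'a cell set) \<Rightarrow> 'a cell set \<Rightarrow> bool" where
  "forest_setting \<Omega> R C \<longleftrightarrow>
     open \<Omega> \<and> bounded \<Omega> \<and>
     (\<forall>l. mesh_of \<Omega> (uniform_mesh R C l) \<and> conforming (uniform_mesh R C l)) \<and>
     (\<forall>K\<in>tree_cells R C. refinement_of K (R K)) \<and>
     (\<exists>\<rho>>0. \<forall>K\<in>tree_cells R C. \<exists>x. ball x (\<rho> * diameter (cell_dom K) / 2) \<subseteq> cell_dom K)"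

inductive forest_mesh :: "('a cell \<Rightarrow> 'a cell set) \<Rightarrow> 'a cell set \<Rightarrow> 'a cell set \<Rightarrow> bool"
  for R :: "'a cell \<Rightarrow> 'a cell set" and C :: "'a cell set" where
  initial: "forest_mesh R C C"
| refining: "forest_mesh R C T \<Longrightarrow> K \<in> T \<Longrightarrow> forest_mesh R C ((T - {K}) \<union> R K)"
| coarsening: "forest_mesh R C T \<Longrightarrow> K \<in> tree_cells R C \<Longrightarrow> R K \<subseteq> T \<Longrightarrow>
    forest_mesh R C (insert K (T - R K))"


section \<open>Neighbors and balance\<close>

definition neighbor ::
    "'a::euclidean_space cell set \<Rightarrow> 'a cell \<Rightarrow> 'a set \<Rightarrow> 'a cell \<Rightarrow> bool" where
  "neighbor T K F K' \<longleftrightarrow>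
     K \<in> T \<and> F \<in> vefs K \<and> K' \<in> T - {K} \<and>
     (\<exists>F'\<in>vefs K'. (F = F' \<or> F' \<subset> F \<or> F \<subset> F') \<and>
        closure F \<inter> closure F' = closure (cell_dom K) \<inter> closure (cell_dom K'))"

definition balanced ::
    "('a::euclidean_space cell \<Rightarrow> 'a cell set) \<Rightarrow> 'a cell set \<Rightarrow> 'a cell set \<Rightarrow> nat \<Rightarrow> bool" where
  "balanced R C T k \<longleftrightarrow>
     (\<forall>K\<in>T. \<forall>n. k \<le> n \<and> n < DIM('a) \<longrightarrow> (\<forall>F\<in>n_faces n K.
        \<not> (\<exists>K'. neighbor T K F K' \<and> \<bar>int (level R C K') - int (level R C K)\<bar> > 1)))"


section \<open>Regular and hanging VEFs, owners\<close>

definition global_vefs :: "'a::euclidean_space cell set \<Rightarrow> 'a set set" where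
  "global_vefs T = (\<Union>K\<in>T. vefs K)"

definition cells_at :: "'a::euclidean_space cell set \<Rightarrow> 'a set \<Rightarrow> 'a cell set" where
  "cells_at T F = {K \<in> T. F \<in> vefs K}"

definition coarse_cells_at :: "'a::euclidean_space cell set \<Rightarrow> 'a set \<Rightarrow> 'a cell set" where
  "coarse_cells_at T F = {K \<in> T. F \<notin> vefs K \<and> F \<subseteq> closure (cell_dom K)}"

definition regular_vefs :: "'a::euclidean_space cell set \<Rightarrow> 'a set set" where
  "regular_vefs T = {F \<in> global_vefs T. coarse_cells_at T F = {}}"

definition hanging_vefs :: "'a::euclidean_space cell set \<Rightarrow> 'a set set" where
  "hanging_vefs T = {F \<in> global_vefs T. coarse_cells_at T F \<noteq> {}}"

definition owner_in :: "'a::euclidean_space cell \<Rightarrow> 'a set \<Rightarrow> 'a set" where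
  "owner_in Kp F = (THE G. G \<in> insert (cell_dom Kp) (vefs Kp) \<and> F \<subseteq> G)"

text \<open>
  \<open>owner_wrt R C T F Kp G\<close>: \<open>G\<close> is the owner of the hanging VEF \<open>F\<close>, computed in the parent \<open>Kp\<close> of
  some cell of \<open>T\<close> that has \<open>F\<close> as a VEF.  This is a relation because independence of the
  choice of that cell is not part of the definition: it fails for general meshes.
\<close>

definition owner_wrt ::
    "('a::euclidean_space cell \<Rightarrow> 'a cell set) \<Rightarrow> 'a cell set \<Rightarrow> 'a cell set \<Rightarrow>
     'a set \<Rightarrow> 'a cell \<Rightarrow> 'a set \<Rightarrow> bool" where
  "owner_wrt R C T F Kp G \<longleftrightarrow>
     F \<in> hanging_vefs T \<and> Kp \<in> tree_cells R C \<and>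
     (\<exists>K\<in>cells_at T F. K \<in> R Kp) \<and> G = owner_in Kp F"


section \<open>Distributed meshes\<close>

text \<open>\<open>proc K\<close> is the processor that owns the cell \<open>K\<close>.\<close>

definition local_cells :: "'a cell set \<Rightarrow> ('a cell \<Rightarrow> nat) \<Rightarrow> nat \<Rightarrow> 'a cell set" where
  "local_cells T proc p = {K \<in> T. proc K = p}"

text \<open>
  Two cells are neighbors across an \<open>n\<close>-face if one is a neighbor of the other across one of the
  \<open>n\<close>-faces of the latter.  The symmetric form matters when a fine cell touches a VEF \<open>F\<close> of a coarse
  cell only in a face of dimension lower than that of \<open>F\<close>.
\<close>

definition ghost_cells ::
    "'a::euclidean_space cell set \<Rightarrow> nat \<Rightarrow> ('a cell \<Rightarrow> nat) \<Rightarrow> nat \<Rightarrow> 'a cell set" where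
  "ghost_cells T s proc p =
     {K' \<in> T - local_cells T proc p. \<exists>K\<in>local_cells T proc p. \<exists>n. s \<le> n \<and> n < DIM('a) \<and>
        ((\<exists>F\<in>n_faces n K. neighbor T K F K') \<or> (\<exists>F\<in>n_faces n K'. neighbor T K' F K))}"

definition proc_cells ::
    "'a::euclidean_space cell set \<Rightarrow> nat \<Rightarrow> ('a cell \<Rightarrow> nat) \<Rightarrow> nat \<Rightarrow> 'a cell set" where
  "proc_cells T s proc p = local_cells T proc p \<union> ghost_cells T s proc p"

definition proc_vefs ::
    "'a::euclidean_space cell set \<Rightarrow> nat \<Rightarrow> ('a cell \<Rightarrow> nat) \<Rightarrow> nat \<Rightarrow> 'a set set" where
  "proc_vefs T s proc p = (\<Union>K\<in>proc_cells T s proc p. vefs K)"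

definition only_ghost_at ::
    "'a::euclidean_space cell set \<Rightarrow> nat \<Rightarrow> ('a cell \<Rightarrow> nat) \<Rightarrow> nat \<Rightarrow> 'a set \<Rightarrow> bool" where
  "only_ghost_at T s proc p F \<longleftrightarrow>
     cells_at T F \<inter> proc_cells T s proc p \<subseteq> ghost_cells T s proc p"

text \<open>
  Rule \<open>bdry\<close> repeats the premises of \<open>owner\<close> for \<open>G\<close>, that is, \<open>G\<close> fulfills condition \<open>owner\<close>.
\<close>

inductive_set proc_local_vefs ::
    "('a::euclidean_space cell \<Rightarrow> 'a cell set) \<Rightarrow> 'a cell set \<Rightarrow> 'a cell set \<Rightarrow> nat \<Rightarrow>
     ('a cell \<Rightarrow> nat) \<Rightarrow> nat \<Rightarrow> 'a set set"
  for R :: "'a cell \<Rightarrow> 'a cell set" and C T :: "'a cell set" and s :: nat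
    and proc :: "'a cell \<Rightarrow> nat" and p :: nat where
  touching: "F \<in> proc_vefs T s proc p \<Longrightarrow>
    cells_at T F \<inter> proc_cells T s proc p \<inter> local_cells T proc p \<noteq> {} \<Longrightarrow>
    F \<in> proc_local_vefs R C T s proc p"
| coarse: "F \<in> proc_vefs T s proc p \<Longrightarrow> only_ghost_at T s proc p F \<Longrightarrow>
    coarse_cells_at T F \<inter> proc_cells T s proc p \<inter> local_cells T proc p \<noteq> {} \<Longrightarrow>
    F \<in> proc_local_vefs R C T s proc p"
| owner: "F \<in> proc_vefs T s proc p \<Longrightarrow> only_ghost_at T s proc p F \<Longrightarrow>
    F' \<in> proc_local_vefs R C T s proc p \<Longrightarrow> owner_wrt R C T F' Kp F \<Longrightarrow>
    F \<in> proc_local_vefs R C T s proc p"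
| bdry: "F \<in> proc_vefs T s proc p \<Longrightarrow> only_ghost_at T s proc p F \<Longrightarrow>
    G \<in> proc_vefs T s proc p \<Longrightarrow> only_ghost_at T s proc p G \<Longrightarrow>
    F' \<in> proc_local_vefs R C T s proc p \<Longrightarrow> owner_wrt R C T F' Kp G \<Longrightarrow>
    F \<subseteq> closure G - G \<Longrightarrow>
    F \<in> proc_local_vefs R C T s proc p"


section \<open>Finite element spaces and hanging DOF constraints\<close>

text \<open>
  \<open>glue K i\<close> is the global DOF of the local DOF \<open>i\<close> of \<open>K\<close>.  The trace \<open>trace_op F u\<close> on a VEF
  \<open>F\<close> is the one relevant for the conformity at hand (full, tangential, normal, or trivial).  The
  value of a hanging DOF \<open>g\<close> is constrained to be a linear combination, with coefficients
  \<open>coeff g g'\<close>, of the values of other DOFs \<open>g'\<close>.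
\<close>

record ('a, 'v, 'w, 'i, 'g) fe_data =
  loc_space :: "'a cell \<Rightarrow> ('a \<Rightarrow> 'v) set"
  loc_dofs :: "'a cell \<Rightarrow> 'i set"
  loc_val :: "'a cell \<Rightarrow> 'i \<Rightarrow> ('a \<Rightarrow> 'v) \<Rightarrow> real"
  loc_owner :: "'a cell \<Rightarrow> 'i \<Rightarrow> 'a set"
  glue :: "'a cell \<Rightarrow> 'i \<Rightarrow> 'g"
  dof_owner :: "'g \<Rightarrow> 'a set"
  trace_op :: "'a set \<Rightarrow> ('a \<Rightarrow> 'v) \<Rightarrow> 'w"
  coeff :: "'g \<Rightarrow> 'g \<Rightarrow> real"

definition local_fe ::
    "('a::euclidean_space, 'v::real_vector, 'w, 'i, 'g) fe_data \<Rightarrow> 'a cell \<Rightarrow> bool" where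
  "local_fe V K \<longleftrightarrow>
     finite (loc_dofs V K) \<and>
     (\<lambda>_. 0) \<in> loc_space V K \<and>
     (\<forall>u\<in>loc_space V K. \<forall>v\<in>loc_space V K. \<forall>a b.
        (\<lambda>x. a *\<^sub>R u x + b *\<^sub>R v x) \<in> loc_space V K \<and>
        (\<forall>i\<in>loc_dofs V K. loc_val V K i (\<lambda>x. a *\<^sub>R u x + b *\<^sub>R v x) =
            a * loc_val V K i u + b * loc_val V K i v)) \<and>
     (\<forall>c. \<exists>!u. u \<in> loc_space V K \<and> (\<forall>i\<in>loc_dofs V K. loc_val V K i u = c i)) \<and>
     (\<forall>i\<in>loc_dofs V K. loc_owner V K i \<in> insert (cell_dom K) (vefs K))"

definition global_dofs ::
    "'a cell set \<Rightarrow> ('a, 'v, 'w, 'i, 'g) fe_data \<Rightarrow> 'g set" where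
  "global_dofs T V = (\<Union>K\<in>T. glue V K ` loc_dofs V K)"

definition hanging_dofs ::
    "'a::euclidean_space cell set \<Rightarrow> ('a, 'v, 'w, 'i, 'g) fe_data \<Rightarrow> 'g set" where
  "hanging_dofs T V = {g \<in> global_dofs T V. dof_owner V g \<in> hanging_vefs T}"

text \<open>
  The DOFs on which the constraint of the hanging DOF \<open>g\<close> depends: all DOFs owned by the owner VEF
  of \<open>dof_owner V g\<close> or by a VEF on its boundary, whether or not their coefficient vanishes.
\<close>

definition constraining_dofs ::
    "('a::euclidean_space cell \<Rightarrow> 'a cell set) \<Rightarrow> 'a cell set \<Rightarrow> 'a cell set \<Rightarrow>
     ('a, 'v, 'w, 'i, 'g) fe_data \<Rightarrow> 'g \<Rightarrow> 'g set" where
  "constraining_dofs R C T V g =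
     {g' \<in> global_dofs T V. \<exists>Kp G. owner_wrt R C T (dof_owner V g) Kp G \<and>
        dof_owner V g' \<in> insert G (boundary_vefs Kp G)}"

definition fe_functions ::
    "('a::euclidean_space cell \<Rightarrow> 'a cell set) \<Rightarrow> 'a cell set \<Rightarrow> 'a cell set \<Rightarrow>
     ('a, 'v, 'w, 'i, 'g) fe_data \<Rightarrow> ('a cell \<Rightarrow> 'a \<Rightarrow> 'v) set" where
  "fe_functions R C T V =
     {u. \<exists>x. (\<forall>K\<in>T. u K \<in> loc_space V K \<and>
                (\<forall>i\<in>loc_dofs V K. loc_val V K i (u K) = x (glue V K i))) \<and>
             (\<forall>g\<in>hanging_dofs T V.
                x g = (\<Sum>g'\<in>constraining_dofs R C T V g. coeff V g g' * x g'))}"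

text \<open>
  The third conjunct is trace continuity across conforming interfaces as a consequence of equal
  global DOF values; the last one is trace continuity across cells of different level.
\<close>

definition conforming_fe_space ::
    "('a::euclidean_space cell \<Rightarrow> 'a cell set) \<Rightarrow> 'a cell set \<Rightarrow> 'a cell set \<Rightarrow>
     ('a, 'v::real_vector, 'w, 'i, 'g) fe_data \<Rightarrow> bool" where
  "conforming_fe_space R C T V \<longleftrightarrow>
     (\<forall>K\<in>T. local_fe V K) \<and>
     (\<forall>K\<in>T. \<forall>i\<in>loc_dofs V K. dof_owner V (glue V K i) = loc_owner V K i) \<and>
     (\<forall>K\<in>T. \<forall>K'\<in>T. \<forall>F\<in>vefs K \<inter> vefs K'.
        closure F = closure (cell_dom K) \<inter> closure (cell_dom K') \<longrightarrow>
        (\<forall>u\<in>loc_space V K. \<forall>u'\<in>loc_space V K'.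
           (\<forall>i\<in>loc_dofs V K. \<forall>i'\<in>loc_dofs V K'.
              glue V K i = glue V K' i' \<longrightarrow> loc_val V K i u = loc_val V K' i' u') \<longrightarrow>
           trace_op V F u = trace_op V F u')) \<and>
     (\<forall>u\<in>fe_functions R C T V. \<forall>F\<in>hanging_vefs T.
        \<forall>K\<in>cells_at T F. \<forall>K'\<in>coarse_cells_at T F. trace_op V F (u K) = trace_op V F (u K'))"

text \<open>$D(\mathcal{V}_h)$; it is $d$ if only cells own DOFs.\<close>

definition min_dof_dim ::
    "'a::euclidean_space cell set \<Rightarrow> ('a, 'v, 'w, 'i, 'g) fe_data \<Rightarrow> nat" where
  "min_dof_dim T V =
     (LEAST n. \<exists>K\<in>T. \<exists>F\<in>n_faces n K. \<exists>g\<in>global_dofs T V. dof_owner V g = F)"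

end

theory Submission
  imports Defs
begin

text \<open>
  The transition map between two cells is differentiable with differentiable inverse on each common
  face, so its derivative maps the tangent space of the face through a point injectively into that
  of the other cell.  Hence the dimension of the face through a point is an invariant of the closed
  face, and by connectedness cells sharing a closed face share all its subfaces.  It follows that
  each face of a descendant lies in one face of every ancestor, and that intersecting a descendant
  with a closed face of an ancestor gives a closed face.

  So if a leaf \<open>K'\<close> is strictly finer than a leaf \<open>K\<close> that it meets at \<open>x\<close>, then \<open>K\<close> and \<open>K'\<close> are
  neighbors across a face of \<open>K\<close> whose closure contains \<open>x\<close>.  If \<open>x\<close> lies in a VEF \<open>F\<close> that is
  hanging because of \<open>K\<close>, this face of \<open>K\<close> has dimension at least \<open>max 1 (dim F)\<close>, which is at least
  \<open>k\<close> if \<open>F\<close> owns DOFs, so that balance applies.  Consequently the owner of \<open>F\<close> and its boundary are VEFs of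
  both the parent and the coarse cell.  A VEF of a cell that has been refined cannot be hanging,
  because the coarse cell responsible for it would meet a leaf at least two levels finer.
\<close>

section \<open>Derivatives of maps into polyhedra\<close>

text \<open>Turns a derivative within an arbitrary set into the ordinary derivative of a curve, to
  which one-variable results on local maxima and uniqueness apply.\<close>

lemma has_derivative_along_line:
  fixes f :: "'a::real_normed_vector \<Rightarrow> 'b::real_normed_vector"
  assumes f: "(f has_derivative L) (at u within S)"
    and "0 < d" and line: "\<And>t. \<bar>t\<bar> < d \<Longrightarrow> u + t *\<^sub>R v \<in> S"
  shows "((\<lambda>t. f (u + t *\<^sub>R v)) has_vector_derivative L v) (at 0)"
proof -
  let ?I = "{-d<..<d}"
  have g: "((\<lambda>t. u + t *\<^sub>R v) has_derivative (\<lambda>t. t *\<^sub>R v)) (at 0 within ?I)"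
    by (auto intro!: derivative_eq_intros)
  have im: "(\<lambda>t. u + t *\<^sub>R v) ` ?I \<subseteq> S"
    using line by (auto simp: abs_less_iff)
  have "((\<lambda>t. f (u + t *\<^sub>R v)) has_derivative (\<lambda>t. L (t *\<^sub>R v))) (at 0 within ?I)"
    using has_derivative_in_compose[OF g, of f L] has_derivative_subset[OF f im] by simp
  moreover have "L (t *\<^sub>R v) = t *\<^sub>R L v" for t
    using f has_derivative_bounded_linear linear_simps(5) by blast
  moreover have "at 0 within ?I = at 0"
    using \<open>0 < d\<close> by (intro at_within_open) auto
  ultimately show ?thesis
    by (simp add: has_vector_derivative_def)
qed

lemma rel_interior_line:
  fixes S :: "'a::euclidean_space set"
  assumes "u \<in> rel_interior S" "w \<in> affine hull S"
  obtains d where "0 < d" "\<And>t. \<bar>t\<bar> < d \<Longrightarrow> u + t *\<^sub>R (w - u) \<in> S"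
proof -
  obtain e where e: "0 < e" "ball u e \<inter> affine hull S \<subseteq> S" and "u \<in> S"
    using assms(1) by (auto simp: mem_rel_interior_ball)
  show ?thesis
  proof (rule that)
    \<comment> \<open>The \<open>+ 1\<close> keeps the denominator positive when
      \<open>w = u\<close>.\<close>
    show "0 < e / (norm (w - u) + 1)"
      using e by (simp add: add_nonneg_pos)
    fix t :: real
    assume t: "\<bar>t\<bar> < e / (norm (w - u) + 1)"
    have "\<bar>t\<bar> * norm (w - u) \<le> \<bar>t\<bar> * (norm (w - u) + 1)"
      by (simp add: mult_left_mono)
    also have "\<dots> < e"
      using t by (simp add: pos_less_divide_eq add_nonneg_pos)
    finally have "u + t *\<^sub>R (w - u) \<in> ball u e"
      by (simp add: dist_norm)
    moreover have "u + t *\<^sub>R (w - u) \<in> affine hull S"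
    proof -
      have "u + t *\<^sub>R (w - u) = (1 - t) *\<^sub>R u + t *\<^sub>R w"
        by (simp add: algebra_simps)
      then show ?thesis
        using mem_affine[OF affine_affine_hull hull_inc[OF \<open>u \<in> S\<close>] assms(2), of "1 - t" t] by simp
    qed
    ultimately show "u + t *\<^sub>R (w - u) \<in> S"
      using e by blast
  qed
qed

text \<open>Along the line, each halfspace of \<open>P\<close> whose boundary contains \<open>f u\<close> yields a local maximum,
  so \<open>L v\<close> is parallel to that boundary.\<close>

lemma derivative_into_face:
  fixes f :: "'a::euclidean_space \<Rightarrow> 'b::euclidean_space"
  assumes f: "(f has_derivative L) (at u within S)"
    and "0 < d" and line: "\<And>t. \<bar>t\<bar> < d \<Longrightarrow> u + t *\<^sub>R v \<in> S"
    and P: "polyhedron P" and fS: "f ` S \<subseteq> P" and h: "h face_of P" "f u \<in> h"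
  shows "\<exists>e>0. f u + e *\<^sub>R L v \<in> h"
proof -
  obtain \<H> where \<H>: "finite \<H>" "P = \<Inter>\<H>"
    and half: "\<And>H. H \<in> \<H> \<Longrightarrow> \<exists>a b. H = {x. a \<bullet> x \<le> b}"
    using P unfolding polyhedron_def by metis
  have P_line: "f (u + t *\<^sub>R v) \<in> P" if "\<bar>t\<bar> < d" for t
    using fS line[OF that] by blast
  have fu: "f u \<in> P"
    using P_line[of 0] \<open>0 < d\<close> by simp
  have "\<forall>H\<in>\<H>. \<exists>e>0. \<forall>t. \<bar>t\<bar> \<le> e \<longrightarrow> f u + t *\<^sub>R L v \<in> H"
  proof
    fix H assume "H \<in> \<H>"
    then obtain a b where H: "H = {x. a \<bullet> x \<le> b}" using half by blast
    have le: "a \<bullet> y \<le> b" if "y \<in> P" for y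
      using that \<H> \<open>H \<in> \<H>\<close> H by auto
    show "\<exists>e>0. \<forall>t. \<bar>t\<bar> \<le> e \<longrightarrow> f u + t *\<^sub>R L v \<in> H"
    proof (cases "a \<bullet> f u = b")
      case True
      have "((\<lambda>t. a \<bullet> f (u + t *\<^sub>R v)) has_real_derivative a \<bullet> L v) (at 0)"
        using bounded_linear.has_vector_derivative[OF bounded_linear_inner_right[of a]
            has_derivative_along_line[OF f \<open>0 < d\<close> line]]
        by (simp add: has_real_derivative_iff_has_vector_derivative)
      then have "a \<bullet> L v = 0"
        by (rule DERIV_local_max[OF _ \<open>0 < d\<close>]) (auto simp: True intro!: le P_line)
      then show ?thesis
        using H True by (intro exI[of _ 1]) (simp add: inner_add_right)
    next
      case False
      then have pos: "a \<bullet> f u < b" using le[OF fu] by simp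
      \<comment> \<open>The halfspace is inactive at \<open>f u\<close>; its slack leaves room for
        steps of this length. The \<open>+ 1\<close> avoids division by zero.\<close>
      define e where "e = (b - a \<bullet> f u) / (\<bar>a \<bullet> L v\<bar> + 1)"
      have "e > 0" using pos by (simp add: e_def add_nonneg_pos)
      moreover have "f u + t *\<^sub>R L v \<in> H" if "\<bar>t\<bar> \<le> e" for t
      proof -
        have "t * (a \<bullet> L v) \<le> \<bar>t\<bar> * \<bar>a \<bullet> L v\<bar>"
          by (metis abs_ge_self abs_mult)
        also have "\<dots> \<le> e * (\<bar>a \<bullet> L v\<bar> + 1)"
          using that \<open>e > 0\<close> by (intro mult_mono) auto
        also have "\<dots> = b - a \<bullet> f u"
          by (simp add: e_def add_nonneg_eq_0_iff)
        finally show ?thesis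
          by (simp add: H inner_add_right)
      qed
      ultimately show ?thesis by blast
    qed
  qed
  then obtain E where E: "\<And>H. H \<in> \<H> \<Longrightarrow> E H > 0"
    "\<And>H t. H \<in> \<H> \<Longrightarrow> \<bar>t\<bar> \<le> E H \<Longrightarrow> f u + t *\<^sub>R L v \<in> H"
    by metis
  \<comment> \<open>Inserting 1 keeps \<open>Min\<close> meaningful when \<open>\<H>\<close> is
    empty, in which case \<open>P\<close> is the whole space.\<close>
  define e where "e = Min (insert 1 (E ` \<H>))"
  have "e > 0" using E(1) \<H>(1) by (simp add: e_def)
  have "e \<le> E H" if "H \<in> \<H>" for H
    using that \<H>(1) by (simp add: e_def)
  then have inP: "f u + t *\<^sub>R L v \<in> P" if "\<bar>t\<bar> \<le> e" for t
    using E(2) that \<H>(2) by force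
  have "f u + e *\<^sub>R L v \<in> h"
  proof (cases "L v = 0")
    case True
    then show ?thesis using h by simp
  next
    case False
    \<comment> \<open>\<open>f u\<close> lies strictly between two points of \<open>P\<close>, so a
      face containing it contains both.\<close>
    have "f u = midpoint (f u + e *\<^sub>R L v) (f u + (- e) *\<^sub>R L v)"
      by (simp add: midpoint_def scaleR_2[symmetric])
    moreover have "f u + e *\<^sub>R L v \<noteq> f u + (- e) *\<^sub>R L v"
      using False \<open>e > 0\<close> by (simp add: eq_neg_iff_add_eq_0 flip: scaleR_2)
    ultimately have "f u \<in> open_segment (f u + e *\<^sub>R L v) (f u + (- e) *\<^sub>R L v)"
      by (metis midpoint_in_open_segment)
    then show ?thesis
      using h inP[of e] inP[of "-e"] \<open>e > 0\<close> unfolding face_of_def by force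
  qed
  with \<open>e > 0\<close> show ?thesis by blast
qed

text \<open>By the chain rule the derivative of \<open>g\<close> is a left inverse of that of
  \<open>f\<close> on the directions of \<open>affine hull S\<close>. So the derivative of
  \<open>f\<close> is injective there, and by \<open>derivative_into_face\<close> it ends in the
  directions of \<open>affine hull h\<close>.\<close>

lemma aff_dim_le_face:
  fixes f :: "'a::euclidean_space \<Rightarrow> 'b::euclidean_space"
  assumes f: "f differentiable (at u within S)"
    and g: "g differentiable (at (f u) within f ` S)"
    and inv: "\<And>y. y \<in> S \<Longrightarrow> g (f y) = y"
    and u: "u \<in> rel_interior S"
    and P: "polyhedron P" and fS: "f ` S \<subseteq> P" and h: "h face_of P" "f u \<in> h"
  shows "aff_dim S \<le> aff_dim h"
proof -
  obtain L where L: "(f has_derivative L) (at u within S)"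
    using f by (auto simp: differentiable_def)
  obtain M where M: "(g has_derivative M) (at (f u) within f ` S)"
    using g by (auto simp: differentiable_def)
  have linL: "linear L" and linM: "linear M"
    using L M has_derivative_bounded_linear bounded_linear.linear by blast+
  have "u \<in> S" using u rel_interior_subset by blast
  then have uA: "u \<in> affine hull S" by (simp add: hull_inc)
  define V where "V = (\<lambda>w. w - u) ` (affine hull S)"
  define W where "W = (\<lambda>w. w - f u) ` (affine hull h)"
  have V: "subspace V"
    unfolding V_def using affine_diffs_subspace_subtract[OF affine_affine_hull uA] .
  have fuh: "f u \<in> affine hull h" using h(2) by (simp add: hull_inc)
  have W: "subspace W"
    unfolding W_def using affine_diffs_subspace_subtract[OF affine_affine_hull fuh] .
  have gf: "((\<lambda>y. g (f y)) has_derivative (\<lambda>y. M (L y))) (at u within S)"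
    by (rule has_derivative_in_compose[OF L M])
  have line: "\<exists>d>0. \<forall>t. \<bar>t\<bar> < d \<longrightarrow> u + t *\<^sub>R v \<in> S" if "v \<in> V" for v
    using that rel_interior_line[OF u] unfolding V_def by blast
  have M_L: "M (L v) = v" if v: "v \<in> V" for v
  proof -
    obtain d where d: "0 < d" "\<And>t. \<bar>t\<bar> < d \<Longrightarrow> u + t *\<^sub>R v \<in> S"
      using line[OF v] by blast
    \<comment> \<open>The same curve is differentiated twice, by the chain rule and through
      \<open>inv\<close>; the two results agree by uniqueness.\<close>
    have "((\<lambda>t. g (f (u + t *\<^sub>R v))) has_vector_derivative M (L v)) (at 0)"
      using has_derivative_along_line[OF gf d] .
    moreover have "((\<lambda>t. g (f (u + t *\<^sub>R v))) has_vector_derivative v) (at 0)"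
    proof -
      have "((\<lambda>t::real. u + t *\<^sub>R v) has_vector_derivative v) (at 0)"
        by (auto intro!: derivative_eq_intros)
      then show ?thesis
        by (rule has_vector_derivative_transform_within_open[where S = "{-d<..<d}"])
          (use d inv in \<open>auto simp: abs_less_iff\<close>)
    qed
    ultimately show ?thesis by (rule vector_derivative_unique_at)
  qed
  then have inj: "inj_on L V" by (metis inj_onI)
  have "L ` V \<subseteq> W"
  proof clarify
    fix v assume v: "v \<in> V"
    obtain d where d: "0 < d" "\<And>t. \<bar>t\<bar> < d \<Longrightarrow> u + t *\<^sub>R v \<in> S"
      using line[OF v] by blast
    obtain e where e: "e > 0" "f u + e *\<^sub>R L v \<in> h"
      using derivative_into_face[OF L d P fS h] by blast
    then have "e *\<^sub>R L v \<in> W"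
      unfolding W_def by (intro image_eqI[of _ _ "f u + e *\<^sub>R L v"]) (auto simp: hull_inc)
    \<comment> \<open>Only a short multiple of \<open>L v\<close> is known to stay in the face; a
      subspace permits rescaling.\<close>
    then have "(1 / e) *\<^sub>R e *\<^sub>R L v \<in> W"
      using W subspace_scale by blast
    then show "L v \<in> W" using e by simp
  qed
  then have "dim (L ` V) \<le> dim W" by (rule dim_subset)
  moreover have "dim (L ` V) = dim V"
    using linL inj V by (simp add: dim_image_eq span_eq_iff[THEN iffD2])
  ultimately have "dim V \<le> dim W" by simp
  moreover have "aff_dim S = int (dim V)"
    unfolding V_def using aff_dim_eq_dim_subtract[of u "affine hull S"] uA
    by (simp add: aff_dim_affine_hull hull_hull)
  moreover have "aff_dim h = int (dim W)"
    unfolding W_def using aff_dim_eq_dim_subtract[of "f u" "affine hull h"] fuh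
    by (simp add: aff_dim_affine_hull hull_hull)
  ultimately show ?thesis by simp
qed

text \<open>The smallest face containing \<open>x\<close> works: were \<open>x\<close> on its
  relative boundary, \<open>x\<close> would lie on a facet, which is again a face of
  \<open>P\<close> and properly smaller.\<close>

lemma polyhedron_point_in_rel_interior_face:
  fixes P :: "'a::euclidean_space set"
  assumes P: "polyhedron P" and x: "x \<in> P"
  obtains g where "g face_of P" "x \<in> rel_interior g"
proof -
  define g where "g = \<Inter>{h. h face_of P \<and> x \<in> h}"
  have "P face_of P" using P by (simp add: face_of_refl polyhedron_imp_convex)
  then have g: "g face_of P"
    unfolding g_def using x by (intro face_of_Inter) auto
  have "x \<in> g" by (simp add: g_def)
  have "x \<in> rel_interior g"
  proof (rule ccontr)
    assume "x \<notin> rel_interior g"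
    then have "x \<in> \<Union>{F. F facet_of g}"
      using \<open>x \<in> g\<close> rel_boundary_of_polyhedron[OF face_of_polyhedron_polyhedron[OF P g]] by blast
    then obtain F where F: "F facet_of g" "x \<in> F" by blast
    then have "F face_of P"
      using g face_of_trans facet_of_imp_face_of by blast
    then have "g \<subseteq> F" unfolding g_def using F by blast
    then show False
      using F facet_of_imp_subset facet_of_irrefl by (metis subset_antisym)
  qed
  with g show ?thesis by (rule that)
qed

section \<open>Faces of cells\<close>

lemma cell_polytope: "is_cell K \<Longrightarrow> polytope (ref_polytope K)"
  by (simp add: is_cell_def)

lemma cell_aff_dim: "is_cell K \<Longrightarrow> aff_dim (ref_polytope K) = int DIM('a)"
  for K :: "'a::euclidean_space cell"
  by (simp add: is_cell_def)

lemma cell_homeomorphism: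
  fixes K :: "'a::euclidean_space cell"
  assumes "is_cell K"
  obtains \<Psi> where
    "homeomorphism (ref_polytope K) (cell_map K ` ref_polytope K) (cell_map K) \<Psi>"
    "cell_map K differentiable_on ref_polytope K"
    "\<Psi> differentiable_on (cell_map K ` ref_polytope K)"
proof -
  have "\<exists>\<Psi>. homeomorphism (ref_polytope K) (cell_map K ` ref_polytope K) (cell_map K) \<Psi> \<and>
          cell_map K differentiable_on ref_polytope K \<and>
          \<Psi> differentiable_on (cell_map K ` ref_polytope K)"
    using assms by (simp only: is_cell_def)
  then show ?thesis using that by (elim exE conjE)
qed

lemma cell_inj_on:
  assumes "is_cell K" shows "inj_on (cell_map K) (ref_polytope K)"
proof -
  obtain \<Psi> where "homeomorphism (ref_polytope K) (cell_map K ` ref_polytope K) (cell_map K) \<Psi>"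
    using assms by (rule cell_homeomorphism)
  then show ?thesis
    by (intro inj_on_inverseI[of _ \<Psi>]) (rule homeomorphism_apply1)
qed

lemma cell_continuous_on:
  assumes "is_cell K" shows "continuous_on (ref_polytope K) (cell_map K)"
proof -
  obtain \<Psi> where "homeomorphism (ref_polytope K) (cell_map K ` ref_polytope K) (cell_map K) \<Psi>"
    using assms by (rule cell_homeomorphism)
  then show ?thesis
    by (rule homeomorphism_cont1)
qed

text \<open>The closure formula rests on compactness: the relative interior is dense in
  \<open>g\<close>, and the continuous image of \<open>g\<close> is closed.\<close>

lemma ref_polytope_face:
  assumes K: "is_cell K" and g: "g face_of ref_polytope K"
  shows "convex g" "compact g" "g \<subseteq> ref_polytope K"
    "closure (cell_map K ` rel_interior g) = cell_map K ` g"
proof -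
  have P: "polytope (ref_polytope K)" using K by (rule cell_polytope)
  show cv: "convex g" and sub: "g \<subseteq> ref_polytope K"
    using g by (auto simp: face_of_imp_convex dest: face_of_imp_subset)
  show co: "compact g"
    using P g face_of_imp_compact polytope_imp_compact polytope_imp_convex by blast
  have cont: "continuous_on g (cell_map K)"
    using cell_continuous_on[OF K] sub continuous_on_subset by blast
  have cl: "closure (rel_interior g) = g"
    using cv co by (simp add: convex_closure_rel_interior compact_imp_closed)
  have "compact (cell_map K ` g)"
    using cont co compact_continuous_image by blast
  then have "closure (cell_map K ` rel_interior g) \<subseteq> cell_map K ` g"
    by (intro closure_minimal compact_imp_closed image_mono rel_interior_subset)
  moreover have "cell_map K ` closure (rel_interior g) \<subseteq> closure (cell_map K ` rel_interior g)"
    by (rule image_closure_subset) (auto simp: cl cont closure_subset)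
  ultimately show "closure (cell_map K ` rel_interior g) = cell_map K ` g"
    by (simp add: cl)
qed

lemma n_facesE:
  assumes "is_cell K" "f \<in> n_faces n K"
  obtains g where "g face_of ref_polytope K" "aff_dim g = int n" "f = cell_map K ` rel_interior g"
    "closure f = cell_map K ` g"
  using assms ref_polytope_face(4) unfolding n_faces_def by blast

lemma rel_interior_ref_polytope:
  "is_cell K \<Longrightarrow> rel_interior (ref_polytope K) = interior (ref_polytope K)"
  using cell_aff_dim[of K] aff_dim_eq_full[of "ref_polytope K"] by (simp add: rel_interior_interior)

lemma cell_dom_in_n_faces: "is_cell K \<Longrightarrow> cell_dom K \<in> n_faces DIM('a) K"
  for K :: "'a::euclidean_space cell"
  unfolding n_faces_def cell_dom_def
  by (rule CollectI, rule exI[of _ "ref_polytope K"])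
    (simp add: rel_interior_ref_polytope face_of_refl polytope_imp_convex cell_polytope cell_aff_dim)

lemma closure_cell_dom:
  assumes "is_cell K" shows "closure (cell_dom K) = cell_map K ` ref_polytope K"
proof -
  have "ref_polytope K face_of ref_polytope K"
    using assms by (simp add: face_of_refl polytope_imp_convex cell_polytope)
  from ref_polytope_face(4)[OF assms this] show ?thesis
    by (simp add: cell_dom_def rel_interior_ref_polytope[OF assms])
qed

lemma open_cell_dom:
  assumes "is_cell K" shows "open (cell_dom K)"
  unfolding cell_dom_def
  using continuous_on_subset[OF cell_continuous_on[OF assms] interior_subset]
    inj_on_subset[OF cell_inj_on[OF assms] interior_subset]
  by (intro invariance_of_domain) auto

lemma n_faces_nonempty:
  assumes "is_cell K" "f \<in> n_faces n K" shows "f \<noteq> {}"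
proof -
  obtain g where g: "g face_of ref_polytope K" "aff_dim g = int n" "f = cell_map K ` rel_interior g"
    using assms by (rule n_facesE)
  then have "g \<noteq> {}" by auto
  then show ?thesis
    using g ref_polytope_face(1)[OF assms(1) g(1)] by (simp add: rel_interior_eq_empty)
qed

lemma cell_dom_nonempty: "is_cell K \<Longrightarrow> cell_dom K \<noteq> {}"
  using cell_dom_in_n_faces n_faces_nonempty by blast

lemma n_faces_connected:
  assumes "is_cell K" "f \<in> n_faces n K" shows "connected f"
proof -
  obtain g where g: "g face_of ref_polytope K" "f = cell_map K ` rel_interior g"
    using assms by (rule n_facesE)
  have "connected (rel_interior g)"
    by (simp add: convex_connected convex_rel_interior ref_polytope_face(1)[OF assms(1) g(1)])
  moreover have "continuous_on (rel_interior g) (cell_map K)"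
    using cell_continuous_on[OF assms(1)] ref_polytope_face(3)[OF assms(1) g(1)]
      rel_interior_subset continuous_on_subset by blast
  ultimately show ?thesis
    by (simp add: g connected_continuous_image)
qed

lemma n_faces_closure_subset:
  assumes "is_cell K" "f \<in> n_faces n K" shows "closure f \<subseteq> closure (cell_dom K)"
proof -
  obtain g where "g face_of ref_polytope K" "closure f = cell_map K ` g"
    using assms by (rule n_facesE)
  then show ?thesis
    using ref_polytope_face(3)[OF assms(1)] by (simp add: closure_cell_dom[OF assms(1)] image_mono)
qed

lemma n_faces_subset: "is_cell K \<Longrightarrow> f \<in> n_faces n K \<Longrightarrow> f \<subseteq> closure (cell_dom K)"
  using n_faces_closure_subset closure_subset by blast

lemma finite_n_faces:
  assumes "is_cell K" shows "finite (n_faces n K)"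
proof -
  have "n_faces n K \<subseteq> (\<lambda>g. cell_map K ` rel_interior g) ` {g. g face_of ref_polytope K}"
    by (auto simp: n_faces_def)
  moreover have "finite {g. g face_of ref_polytope K}"
    using assms by (simp add: finite_polytope_faces cell_polytope)
  ultimately show ?thesis
    using finite_surj by blast
qed

section \<open>Incidence of the faces of one cell\<close>

lemma n_faces_cover:
  assumes "is_cell K" "x \<in> closure (cell_dom K)"
  obtains n f where "f \<in> n_faces n K" "x \<in> f"
proof -
  obtain u where u: "u \<in> ref_polytope K" "x = cell_map K u"
    using assms by (auto simp: closure_cell_dom)
  have "polyhedron (ref_polytope K)"
    using assms by (simp add: polytope_imp_polyhedron cell_polytope)
  then obtain g where g: "g face_of ref_polytope K" "u \<in> rel_interior g"
    using u polyhedron_point_in_rel_interior_face by blast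
  then have "g \<noteq> {}" using rel_interior_subset by blast
  then have "aff_dim g = int (nat (aff_dim g))"
    by (metis aff_dim_negative_iff int_nat_eq not_less)
  then show ?thesis
    using that[of "cell_map K ` rel_interior g" "nat (aff_dim g)"] g u
    unfolding n_faces_def by blast
qed

text \<open>Since \<open>cell_map K\<close> is injective, this transports the face lattice of the
  reference polytope: a face meeting another closed face in its relative interior lies in it, and a
  proper subface has smaller dimension.\<close>

lemma n_faces_meet:
  assumes K: "is_cell K" and f: "f \<in> n_faces n K" and f': "f' \<in> n_faces m K"
    and x: "x \<in> f" "x \<in> closure f'"
  shows "f \<subseteq> closure f'" "closure f \<subseteq> closure f'" "n \<le> m" "m \<le> n \<Longrightarrow> f = f'"
proof -
  obtain g where g: "g face_of ref_polytope K" "aff_dim g = int n" "f = cell_map K ` rel_interior g"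
    "closure f = cell_map K ` g"
    using K f by (rule n_facesE)
  obtain g' where g': "g' face_of ref_polytope K" "aff_dim g' = int m"
    "f' = cell_map K ` rel_interior g'" "closure f' = cell_map K ` g'"
    using K f' by (rule n_facesE)
  note sub = ref_polytope_face(3)[OF K g(1)] ref_polytope_face(3)[OF K g'(1)]
  obtain u v where u: "u \<in> rel_interior g" "cell_map K u = x" and v: "v \<in> g'" "cell_map K v = x"
    using x g g' by auto
  moreover have "u \<in> g" using u rel_interior_subset by blast
  ultimately have "u = v"
    using inj_onD[OF cell_inj_on[OF K]] sub by (metis subsetD)
  then have gg': "g \<subseteq> g'"
    using subset_of_face_of[OF g'(1) sub(1)] u v by blast
  then show cl: "closure f \<subseteq> closure f'" using g g' by auto
  then show "f \<subseteq> closure f'" using closure_subset by blast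
  show "n \<le> m" using aff_dim_subset[OF gg'] g g' by simp
  show "f = f'" if "m \<le> n"
  proof -
    have gf: "g face_of g'" using g(1) g'(1) gg' sub face_of_subset by blast
    have "g = g'"
    proof (rule ccontr)
      assume "g \<noteq> g'"
      then have "aff_dim g < aff_dim g'"
        using gf ref_polytope_face(1)[OF K g'(1)] by (simp add: face_of_aff_dim_lt)
      then show False using g g' that by simp
    qed
    then show ?thesis using g g' by simp
  qed
qed

lemma n_faces_eq_cell_dom:
  fixes K :: "'a::euclidean_space cell"
  assumes K: "is_cell K" and f: "f \<in> n_faces n K"
  shows "n \<le> DIM('a)" "n = DIM('a) \<Longrightarrow> f = cell_dom K"
proof -
  note d = cell_dom_in_n_faces[OF K]
  obtain y where "y \<in> f" using n_faces_nonempty[OF K f] by blast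
  then have y: "y \<in> f" "y \<in> closure (cell_dom K)" using n_faces_subset[OF K f] by blast+
  show "n \<le> DIM('a)" "n = DIM('a) \<Longrightarrow> f = cell_dom K"
    using n_faces_meet[OF K f d y] by auto
qed

section \<open>Faces shared by two cells\<close>

text \<open>The derivative of the transition map from \<open>K\<close> to \<open>K'\<close> is injective on the tangent
  space of \<open>f\<close> and maps it into that of \<open>f'\<close>.\<close>

lemma n_faces_dim_le:
  assumes K: "is_cell K" and K': "is_cell K'" and f: "f \<in> n_faces n K" and f': "f' \<in> n_faces m K'"
    and sub: "f \<subseteq> closure (cell_dom K')" and x: "x \<in> f" "x \<in> f'"
  shows "n \<le> m"
proof -
  let ?\<Phi> = "cell_map K" and ?P = "ref_polytope K" and ?\<Phi>' = "cell_map K'" and ?P' = "ref_polytope K'"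
  obtain g where g: "g face_of ?P" "aff_dim g = int n" "f = ?\<Phi> ` rel_interior g"
    using K f by (rule n_facesE)
  obtain g' where g': "g' face_of ?P'" "aff_dim g' = int m" "f' = ?\<Phi>' ` rel_interior g'"
    using K' f' by (rule n_facesE)
  obtain \<Psi> where \<Psi>: "homeomorphism ?P (?\<Phi> ` ?P) ?\<Phi> \<Psi>" "?\<Phi> differentiable_on ?P"
    "\<Psi> differentiable_on (?\<Phi> ` ?P)"
    using K by (rule cell_homeomorphism)
  obtain \<Psi>' where \<Psi>': "homeomorphism ?P' (?\<Phi>' ` ?P') ?\<Phi>' \<Psi>'"
    "?\<Phi>' differentiable_on ?P'" "\<Psi>' differentiable_on (?\<Phi>' ` ?P')"
    using K' by (rule cell_homeomorphism)
  have D: "q differentiable (at y within A)" if "q differentiable_on B" "A \<subseteq> B" "y \<in> B"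
    for q :: "'a \<Rightarrow> 'a" and A B y
    using that by (meson differentiable_on_def differentiable_within_subset)
  let ?S = "rel_interior g"
  have SP: "?S \<subseteq> ?P" using ref_polytope_face(3)[OF K g(1)] rel_interior_subset by blast
  have fP': "?\<Phi> ` ?S \<subseteq> ?\<Phi>' ` ?P'"
    using sub g closure_cell_dom[OF K'] by simp
  obtain u where u: "u \<in> ?S" "?\<Phi> u = x" using x g by blast
  have inv1: "\<Psi> (?\<Phi> y) = y" if "y \<in> ?P" for y
    using that \<Psi>(1) homeomorphism_apply1 by blast
  have inv2: "?\<Phi>' (\<Psi>' z) = z" if "z \<in> ?\<Phi>' ` ?P'" for z
    using that \<Psi>'(1) homeomorphism_apply2 by blast
  have inv3: "\<Psi>' (?\<Phi>' z) = z" if "z \<in> ?P'" for z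
    using that \<Psi>'(1) homeomorphism_apply1 by blast
  \<comment> \<open>The transition map between the two reference polytopes and its inverse. The maps
    are differentiable only within given sets, so the chain rule needs the images under control:
    \<open>im\<close> and \<open>imim\<close>.\<close>
  let ?\<phi> = "\<Psi>' \<circ> ?\<Phi>" and ?\<chi> = "\<Psi> \<circ> ?\<Phi>'"
  have im: "?\<phi> ` ?S \<subseteq> ?P'"
    using fP' inv3 by fastforce
  have imim: "?\<Phi>' ` ?\<phi> ` ?S = ?\<Phi> ` ?S"
    using fP' inv2 by (force simp: image_iff)
  have \<phi>u: "?\<phi> u \<in> g'"
  proof -
    obtain v where v: "v \<in> rel_interior g'" "?\<Phi>' v = x" using x g' by blast
    then have "v \<in> g'" using rel_interior_subset by blast
    then have "?\<phi> u = v"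
      using v u inv3[of v] ref_polytope_face(3)[OF K' g'(1)] by auto
    with \<open>v \<in> g'\<close> show ?thesis by simp
  qed
  have "?\<phi> differentiable (at u within ?S)"
  proof (rule differentiable_chain_within)
    show "?\<Phi> differentiable (at u within ?S)"
      using D[OF \<Psi>(2) SP] u SP by blast
    show "\<Psi>' differentiable (at (?\<Phi> u) within ?\<Phi> ` ?S)"
      using D[OF \<Psi>'(3) fP'] u fP' by blast
  qed
  moreover have "?\<chi> differentiable (at (?\<phi> u) within ?\<phi> ` ?S)"
  proof (rule differentiable_chain_within)
    show "?\<Phi>' differentiable (at (?\<phi> u) within ?\<phi> ` ?S)"
      using D[OF \<Psi>'(2) im] u im by blast
    have "?\<Phi>' (?\<phi> u) \<in> ?\<Phi> ` ?P"
      using u SP imim by blast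
    moreover have "?\<Phi>' ` ?\<phi> ` ?S \<subseteq> ?\<Phi> ` ?P"
      using imim SP by blast
    ultimately show "\<Psi> differentiable (at (?\<Phi>' (?\<phi> u)) within ?\<Phi>' ` ?\<phi> ` ?S)"
      using D[OF \<Psi>(3)] by blast
  qed
  moreover have "?\<chi> (?\<phi> y) = y" if "y \<in> ?S" for y
  proof -
    have "?\<Phi> y \<in> ?\<Phi>' ` ?P'" "y \<in> ?P" using that fP' SP by blast+
    then show ?thesis using inv1 inv2 by simp
  qed
  moreover have "u \<in> rel_interior ?S"
    using u ref_polytope_face(1)[OF K g(1)] by (simp add: rel_interior_rel_interior)
  ultimately have "aff_dim ?S \<le> aff_dim g'"
    using aff_dim_le_face[of ?\<phi> u ?S ?\<chi> ?P' g'] im \<phi>u g'(1) polytope_imp_polyhedron[OF cell_polytope[OF K']]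
    by blast
  then show ?thesis
    using g g' ref_polytope_face(1)[OF K g(1)] by (simp add: rel_interior_aff_dim)
qed

text \<open>Each of \<open>h\<close> and \<open>h'\<close> lies in the common closed face, hence in
  the other closed cell, so \<open>n_faces_dim_le\<close> applies in both directions.\<close>

lemma n_faces_dim_eq:
  assumes K: "is_cell K" and K': "is_cell K'" and f: "f \<in> n_faces n K" and f': "f' \<in> n_faces m K'"
    and cl: "closure f = closure f'" and x: "x \<in> closure f"
    and h: "h \<in> n_faces i K" "x \<in> h" and h': "h' \<in> n_faces j K'" "x \<in> h'"
  shows "i = j"
proof -
  have "h \<subseteq> closure (cell_dom K')" "h' \<subseteq> closure (cell_dom K)"
    using n_faces_meet(1)[OF K h(1) f h(2) x] n_faces_meet(1)[OF K' h'(1) f' h'(2)] x cl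
      n_faces_closure_subset[OF K f] n_faces_closure_subset[OF K' f'] by auto
  then show ?thesis
    using n_faces_dim_le[OF K K' h(1) h'(1) _ h(2) h'(2)]
      n_faces_dim_le[OF K' K h'(1) h(1) _ h'(2) h(2)] by simp
qed

text \<open>\<open>h\<close> is covered by the \<open>j\<close>-faces of \<open>K'\<close> by equality of dimensions, and these are
  relatively closed in their union, so that the connected set \<open>h\<close> lies in one of them.\<close>

lemma n_faces_subset_common:
  assumes K: "is_cell K" and K': "is_cell K'" and f: "f \<in> n_faces n K" and f': "f' \<in> n_faces m K'"
    and cl: "closure f = closure f'" and h: "h \<in> n_faces j K" "h \<subseteq> closure f"
  obtains h' where "h' \<in> n_faces j K'" "h \<subseteq> h'"
proof -
  have in_face: "\<exists>h'\<in>n_faces j K'. x \<in> h'" if "x \<in> h" for x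
  proof -
    have x: "x \<in> closure f" "x \<in> closure (cell_dom K')"
      using that h(2) cl n_faces_closure_subset[OF K' f'] by auto
    obtain i h' where "h' \<in> n_faces i K'" "x \<in> h'"
      using n_faces_cover[OF K' x(2)] .
    then show ?thesis
      using n_faces_dim_eq[OF K K' f f' cl x(1) h(1) that] by blast
  qed
  obtain x where x: "x \<in> h" using n_faces_nonempty[OF K h(1)] by blast
  obtain h' where h': "h' \<in> n_faces j K'" "x \<in> h'" using in_face[OF x] by blast
  define B where "B = (\<Union>k\<in>n_faces j K' - {h'}. closure k)"
  have "closed B" unfolding B_def using finite_n_faces[OF K'] by (intro closed_UN) auto
  have "h \<subseteq> closure h' \<union> B"
    using in_face closure_subset unfolding B_def by blast
  moreover have "closure h' \<inter> B \<inter> h = {}"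
  proof (rule ccontr)
    assume "closure h' \<inter> B \<inter> h \<noteq> {}"
    then obtain y k where y: "y \<in> h" "y \<in> closure h'"
      and k: "k \<in> n_faces j K'" "k \<noteq> h'" "y \<in> closure k"
      unfolding B_def by blast
    \<comment> \<open>The \<open>j\<close>-face through \<open>y\<close> meets both
      \<open>closure k\<close> and \<open>closure h'\<close>; having the same dimension, it equals
      both.\<close>
    obtain e where e: "e \<in> n_faces j K'" "y \<in> e" using in_face[OF y(1)] by blast
    have "e = k" "e = h'"
      using n_faces_meet(4)[OF K' e(1) k(1) e(2) k(3)] n_faces_meet(4)[OF K' e(1) h'(1) e(2) y(2)]
      by simp_all
    with k show False by simp
  qed
  moreover have "closure h' \<inter> h \<noteq> {}" using x h' closure_subset by blast
  ultimately have "B \<inter> h = {}"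
    using connected_closedD[OF n_faces_connected[OF K h(1)], of "closure h'" B] \<open>closed B\<close> by auto
  then have "h \<subseteq> h'"
    using in_face closure_subset unfolding B_def by blast
  with h' show ?thesis using that by blast
qed

text \<open>Using \<open>n_faces_subset_common\<close> in both directions encloses a face
  \<open>h'\<close> of \<open>K'\<close> between \<open>h\<close> and a \<open>j\<close>-face of
  \<open>K\<close>; the two faces of \<open>K\<close> meet and have equal dimension, so all three
  coincide.\<close>

lemma n_faces_common_subset_face:
  assumes K: "is_cell K" and K': "is_cell K'" and f: "f \<in> n_faces n K" and f': "f' \<in> n_faces m K'"
    and cl: "closure f = closure f'" and h: "h \<in> n_faces j K" "h \<subseteq> closure f"
  shows "h \<in> n_faces j K'"
proof -
  obtain h' where h': "h' \<in> n_faces j K'" "h \<subseteq> h'"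
    using n_faces_subset_common[OF assms] .
  obtain x where x: "x \<in> h" using n_faces_nonempty[OF K h(1)] by blast
  have "x \<in> h'" "x \<in> closure f'" using x h(2) h'(2) cl by auto
  then have "h' \<subseteq> closure f'"
    by (rule n_faces_meet(1)[OF K' h'(1) f'])
  then obtain h'' where h'': "h'' \<in> n_faces j K" "h' \<subseteq> h''"
    by (rule n_faces_subset_common[OF K' K f' f cl[symmetric] h'(1)])
  have "x \<in> closure h''" using x h'(2) h''(2) closure_subset by blast
  then have "h = h''"
    using n_faces_meet(4)[OF K h(1) h''(1) x] by simp
  then have "h = h'" using h'(2) h''(2) by simp
  then show ?thesis using h'(1) by simp
qed

text \<open>Both sets become faces of \<open>K'\<close>, where an open face is determined by its
  closure. This matters because \<open>conforming\<close> equates only closures.\<close>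

lemma n_faces_closure_eq:
  assumes K: "is_cell K" and K': "is_cell K'" and f: "f \<in> n_faces n K" and f': "f' \<in> n_faces m K'"
    and cl: "closure f = closure f'"
  shows "n = m" "f = f'"
proof -
  have fn: "f \<in> n_faces n K'"
    by (rule n_faces_common_subset_face[OF assms f closure_subset])
  obtain x where x: "x \<in> f" using n_faces_nonempty[OF K f] by blast
  obtain y where y: "y \<in> f'" using n_faces_nonempty[OF K' f'] by blast
  have x': "x \<in> closure f'" and y': "y \<in> closure f"
    using x y cl closure_subset by (metis subsetD)+
  show nm: "n = m"
    using n_faces_meet(3)[OF K' fn f' x x'] n_faces_meet(3)[OF K' f' fn y y'] by (rule le_antisym)
  show "f = f'"
    by (rule n_faces_meet(4)[OF K' fn f' x x']) (simp add: nm)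
qed

section \<open>Uniform refinements\<close>

lemma n_faces_0_singleton:
  assumes "is_cell K" "f \<in> n_faces 0 K" "x \<in> f" shows "f = {x}"
proof -
  obtain g where g: "aff_dim g = int 0" "f = cell_map K ` rel_interior g"
    using assms(1,2) by (rule n_facesE)
  then obtain a where "g = {a}" by (auto simp: aff_dim_eq_0)
  then show ?thesis using g assms(3) by auto
qed

lemma vefs_iff: "F \<in> vefs K \<longleftrightarrow> (\<exists>n<DIM('a). F \<in> n_faces n K)"
  for K :: "'a::euclidean_space cell"
  by (auto simp: vefs_def)

locale forest =
  fixes \<Omega> :: "'a::euclidean_space set" and R :: "'a cell \<Rightarrow> 'a cell set" and C :: "'a cell set"
  assumes setting: "forest_setting \<Omega> R C"
begin

abbreviation "U l \<equiv> uniform_mesh R C l"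

lemma mesh_U: "mesh_of \<Omega> (U l)" and conforming_U: "conforming (U l)"
  using setting unfolding forest_setting_def by blast+

lemma refinement: "K \<in> U l \<Longrightarrow> refinement_of K (R K)"
  using setting unfolding forest_setting_def tree_cells_def by blast

lemma cell_U: "K \<in> U l \<Longrightarrow> is_cell K"
  using mesh_U unfolding mesh_of_def by blast

lemma U_overlap:
  assumes "K \<in> U l" "K' \<in> U l" "cell_dom K \<inter> cell_dom K' \<noteq> {}"
  shows "K = K'"
  using mesh_U[of l] assms unfolding mesh_of_def pairwise_def disjnt_def by metis

lemma child_U: "X \<in> U l \<Longrightarrow> K \<in> R X \<Longrightarrow> K \<in> U (Suc l)"
  by auto

lemma child_subset: "X \<in> U l \<Longrightarrow> K \<in> R X \<Longrightarrow> cell_dom K \<subseteq> cell_dom X"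
  using refinement unfolding refinement_of_def mesh_of_def by blast

text \<open>The descendants of \<open>X\<close> after \<open>m\<close> refinements are encoded as
  the uniform refinement of the one-cell mesh \<open>{X}\<close>.\<close>

lemma descendant_U: "X \<in> U l \<Longrightarrow> K \<in> uniform_mesh R {X} m \<Longrightarrow> K \<in> U (l + m)"
  by (induction m arbitrary: K) auto

lemma ancestor: "K \<in> U (l + m) \<Longrightarrow> \<exists>X\<in>U l. K \<in> uniform_mesh R {X} m"
proof (induction m arbitrary: K)
  case (Suc m)
  then obtain Y where "Y \<in> U (l + m)" "K \<in> R Y" by auto
  with Suc.IH show ?case by fastforce
qed simp

lemma descendant_subset: "X \<in> U l \<Longrightarrow> K \<in> uniform_mesh R {X} m \<Longrightarrow> cell_dom K \<subseteq> cell_dom X"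
proof (induction m arbitrary: K)
  case (Suc m)
  then obtain Y where Y: "Y \<in> uniform_mesh R {X} m" "K \<in> R Y" by auto
  then show ?case
    using Suc child_subset[OF descendant_U[OF Suc.prems(1) Y(1)] Y(2)] by blast
qed simp

text \<open>A child filling the parent would leave no room for another member of the restriction to
  the \<open>d\<close>-face, whose partition would then be trivial.\<close>

lemma child_psubset:
  assumes X: "X \<in> U l" and K: "K \<in> R X" shows "cell_dom K \<noteq> cell_dom X"
proof
  assume eq: "cell_dom K = cell_dom X"
  let ?r = "restriction (R X) DIM('a) (cell_dom X)"
  have cX: "is_cell X" using X by (rule cell_U)
  have np: "nontrivial_face_partition (R X) DIM('a) (cell_dom X)"
    using refinement[OF X] cell_dom_in_n_faces[OF cX] unfolding refinement_of_def by simp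
  have "cell_dom K \<in> n_faces DIM('a) K"
    using cell_U[OF child_U[OF X K]] by (rule cell_dom_in_n_faces)
  then have r: "cell_dom X \<in> ?r"
    unfolding restriction_def using K eq by auto
  moreover have "g = cell_dom X" if g: "g \<in> ?r" for g
  proof (rule ccontr)
    assume "g \<noteq> cell_dom X"
    then have "disjnt g (cell_dom X)"
      using np g r unfolding nontrivial_face_partition_def pairwise_def by blast
    moreover have "g \<subseteq> cell_dom X" using g by (simp add: restriction_def)
    ultimately have "g = {}" by (auto simp: disjnt_def)
    moreover obtain K' where "K' \<in> R X" "g \<in> n_faces DIM('a) K'"
      using g by (auto simp: restriction_def)
    ultimately show False
      using n_faces_nonempty[OF cell_U[OF child_U[OF X]]] by blast
  qed
  ultimately have "?r = {cell_dom X}" by blast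
  then show False
    using np unfolding nontrivial_face_partition_def by blast
qed

text \<open>If \<open>i < j\<close>, let \<open>Y\<close> be the ancestor of \<open>K\<close> on
  level \<open>i + 1\<close> and \<open>X\<close> its parent. Overlap forces \<open>K = X\<close>,
  so \<open>Y\<close> would fill its parent.\<close>

lemma U_level_unique:
  assumes "K \<in> U i" "K \<in> U j" shows "i = j"
proof -
  have False if ij: "i < j" and K: "K \<in> U i" "K \<in> U j" for i j
  proof -
    obtain m where j: "j = Suc i + m" using less_iff_Suc_add[of i j] ij by auto
    obtain Y where Y: "Y \<in> U (Suc i)" "K \<in> uniform_mesh R {Y} m"
      using ancestor K(2) j by blast
    then obtain X where X: "X \<in> U i" "Y \<in> R X" by auto
    have KY: "cell_dom K \<subseteq> cell_dom Y" using Y by (rule descendant_subset)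
    have YX: "cell_dom Y \<subseteq> cell_dom X" using X by (rule child_subset)
    have "K = X"
      by (rule U_overlap[OF K(1) X(1)]) (use KY YX cell_dom_nonempty[OF cell_U[OF K(1)]] in blast)
    then show False
      using KY YX child_psubset[OF X] by blast
  qed
  then show ?thesis using assms by (metis nat_neq_iff)
qed

lemma level_U: "K \<in> U l \<Longrightarrow> level R C K = l"
  unfolding level_def using U_level_unique by (intro Least_equality) auto

section \<open>Faces of descendants compared with faces of ancestors\<close>

lemma closure_descendant_subset:
  "X \<in> U l \<Longrightarrow> K \<in> uniform_mesh R {X} m \<Longrightarrow> closure (cell_dom K) \<subseteq> closure (cell_dom X)"
  by (intro closure_mono descendant_subset)

text \<open>For \<open>n > 0\<close> this is part of the refinement hypothesis. That hypothesis does
  not cover vertices; there the dimension bound shows that the face of the child through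
  \<open>x\<close> is itself a vertex.\<close>

lemma child_inter_face:
  assumes X: "X \<in> U l" and K: "K \<in> R X" and Y: "Y \<in> n_faces n X"
    and x: "x \<in> closure (cell_dom K)" "x \<in> closure Y"
  obtains m g where "g \<in> n_faces m K" "closure (cell_dom K) \<inter> closure Y = closure g"
proof (cases "n = 0")
  case True
  have cX: "is_cell X" and cK: "is_cell K"
    using cell_U X child_U[OF X K] by blast+
  obtain y where "y \<in> Y" using n_faces_nonempty[OF cX Y] by blast
  then have "Y = {y}" using n_faces_0_singleton[OF cX] Y True by blast
  then have Yx: "Y = {x}" using x by simp
  obtain m g where g: "g \<in> n_faces m K" "x \<in> g"
    using n_faces_cover[OF cK x(1)] .
  have "g \<subseteq> closure (cell_dom X)"
    using n_faces_subset[OF cK g(1)] closure_mono[OF child_subset[OF X K]] by blast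
  then have "m \<le> n"
    by (rule n_faces_dim_le[OF cK cX g(1) Y _ g(2)]) (simp add: Yx)
  then have "g = {x}" using n_faces_0_singleton[OF cK _ g(2)] g(1) True by simp
  then show ?thesis using that[OF g(1)] x Yx by auto
next
  case False
  have "n \<le> DIM('a)" using n_faces_eq_cell_dom(1)[OF cell_U[OF X] Y] .
  then have "nontrivial_face_partition (R X) n Y"
    using refinement[OF X] Y False unfolding refinement_of_def by simp
  then have "closure (cell_dom K) \<inter> closure Y = {} \<or>
        (\<exists>m. \<exists>g\<in>n_faces m K. closure (cell_dom K) \<inter> closure Y = closure g)"
    using K unfolding nontrivial_face_partition_def by blast
  then show ?thesis using x that by blast
qed

text \<open>The face \<open>G\<close> of the parent is chosen of minimal dimension among those meeting \<open>g\<close>.\<close>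

lemma child_face_in_face:
  assumes X: "X \<in> U l" and K: "K \<in> R X" and g: "g \<in> n_faces m K"
  obtains n G where "G \<in> n_faces n X" "g \<subseteq> G"
proof -
  have cX: "is_cell X" and cK: "is_cell K"
    using cell_U X child_U[OF X K] by blast+
  have gX: "g \<subseteq> closure (cell_dom X)"
    using n_faces_subset[OF cK g] closure_mono[OF child_subset[OF X K]] by blast
  define Q where "Q = (\<lambda>n. \<exists>x\<in>g. \<exists>G\<in>n_faces n X. x \<in> G)"
  obtain z where "z \<in> g" using n_faces_nonempty[OF cK g] by blast
  moreover from this obtain j H where "H \<in> n_faces j X" "z \<in> H"
    using n_faces_cover[OF cX] gX by blast
  ultimately have "Q j" unfolding Q_def by blast
  define n where "n = (LEAST n. Q n)"
  have least: "n \<le> i" if "Q i" for i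
    unfolding n_def using that by (rule Least_le)
  have "Q n" unfolding n_def using \<open>Q j\<close> by (rule LeastI)
  then obtain x G where x: "x \<in> g" "x \<in> G" and G: "G \<in> n_faces n X"
    unfolding Q_def by blast
  have xc: "x \<in> closure (cell_dom K)" "x \<in> closure G"
    using x n_faces_subset[OF cK g] closure_subset by blast+
  obtain m' g' where g': "g' \<in> n_faces m' K" "closure (cell_dom K) \<inter> closure G = closure g'"
    using child_inter_face[OF X K G xc] .
  \<comment> \<open>The child meets \<open>closure G\<close> in a closed face \<open>g'\<close>,
    which contains \<open>g\<close> because it contains a point of the open face
    \<open>g\<close>.\<close>
  have "g \<subseteq> closure g'"
    by (rule n_faces_meet(1)[OF cK g g'(1) x(1)]) (use g'(2) xc in blast)
  then have gG: "g \<subseteq> closure G" using g'(2) by blast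
  have "y \<in> G" if y: "y \<in> g" for y
  proof -
    have "y \<in> closure (cell_dom X)" using y gX by blast
    then obtain i G' where G': "G' \<in> n_faces i X" "y \<in> G'"
      by (rule n_faces_cover[OF cX])
    \<comment> \<open>Minimality of \<open>n\<close> excludes that \<open>y\<close> lies on the
      relative boundary of \<open>G\<close>.\<close>
    have "n \<le> i" by (rule least) (use y G' in \<open>auto simp: Q_def\<close>)
    moreover have "y \<in> closure G" using gG y by blast
    ultimately have "G' = G" by (rule n_faces_meet(4)[OF cX G'(1) G G'(2), rotated])
    then show ?thesis using G' by simp
  qed
  then show ?thesis using that[OF G] by blast
qed

lemma descendant_face_in_face:
  assumes X: "X \<in> U l"
  shows "K \<in> uniform_mesh R {X} m \<Longrightarrow> g \<in> n_faces j K \<Longrightarrow> \<exists>n. \<exists>G\<in>n_faces n X. g \<subseteq> G"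
proof (induction m arbitrary: K g j)
  case 0
  then show ?case by auto
next
  case (Suc m)
  then obtain Y where Y: "Y \<in> uniform_mesh R {X} m" "K \<in> R Y" by auto
  obtain n G where G: "G \<in> n_faces n Y" "g \<subseteq> G"
    using child_face_in_face[OF descendant_U[OF X Y(1)] Y(2) Suc.prems(2)] .
  obtain i H where "H \<in> n_faces i X" "G \<subseteq> H"
    using Suc.IH[OF Y(1) G(1)] by blast
  then show ?case using G(2) by (meson subset_trans)
qed

text \<open>Each refinement step intersects the child with the closed face that its parent cuts out
  of \<open>closure Y\<close>.\<close>

lemma descendant_inter_face:
  assumes X: "X \<in> U l" and Y: "Y \<in> n_faces n X"
  shows "K \<in> uniform_mesh R {X} m \<Longrightarrow> x \<in> closure (cell_dom K) \<Longrightarrow> x \<in> closure Y \<Longrightarrow>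
    \<exists>j. \<exists>g\<in>n_faces j K. closure (cell_dom K) \<inter> closure Y = closure g"
proof (induction m arbitrary: K)
  case 0
  then show ?case using Y n_faces_closure_subset[OF cell_U[OF X] Y] by auto
next
  case (Suc m)
  then obtain Z where Z: "Z \<in> uniform_mesh R {X} m" "K \<in> R Z" by auto
  have ZU: "Z \<in> U (l + m)" using X Z(1) by (rule descendant_U)
  have sub: "closure (cell_dom K) \<subseteq> closure (cell_dom Z)"
    using child_subset[OF ZU Z(2)] by (rule closure_mono)
  then have "x \<in> closure (cell_dom Z)" using Suc.prems by blast
  then obtain j g where g: "g \<in> n_faces j Z" "closure (cell_dom Z) \<inter> closure Y = closure g"
    using Suc.IH[OF Z(1) _ Suc.prems(3)] by blast
  have "x \<in> closure g" using g(2) Suc.prems sub by blast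
  then obtain i e where "e \<in> n_faces i K" "closure (cell_dom K) \<inter> closure g = closure e"
    using child_inter_face[OF ZU Z(2) g(1) Suc.prems(2)] by blast
  moreover have "closure (cell_dom K) \<inter> closure g = closure (cell_dom K) \<inter> closure Y"
    using g(2) sub by blast
  ultimately show ?case by (metis (no_types))
qed

text \<open>Strengthens conformity from equal closures to one shared open VEF.\<close>

lemma U_conforming:
  assumes X: "X \<in> U l" "Y \<in> U l" "X \<noteq> Y" and x: "x \<in> closure (cell_dom X)" "x \<in> closure (cell_dom Y)"
  obtains h H where "h < DIM('a)" "H \<in> n_faces h X" "H \<in> n_faces h Y"
    "closure H = closure (cell_dom X) \<inter> closure (cell_dom Y)"
proof -
  obtain H H' where H: "H \<in> vefs X" "H' \<in> vefs Y" "closure H = closure H'"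
    "closure H = closure (cell_dom X) \<inter> closure (cell_dom Y)"
    using conforming_U[of l] X x unfolding conforming_def by blast
  obtain h h' where h: "h < DIM('a)" "H \<in> n_faces h X" "H' \<in> n_faces h' Y"
    using H(1,2) unfolding vefs_iff by blast
  have "h = h'" "H = H'"
    using n_faces_closure_eq[OF cell_U[OF X(1)] cell_U[OF X(2)] h(2,3) H(3)] by auto
  then show ?thesis using that h H(4) by blast
qed

text \<open>The ancestor \<open>X\<close> of \<open>B\<close> on the level of \<open>A\<close> has
  the face \<open>F\<close> by conformity. Descending, \<open>B\<close> cuts a closed face out of
  \<open>closure F\<close>, and this is all of \<open>closure F\<close>.\<close>

lemma face_inherited:
  assumes A: "A \<in> U i" and B: "B \<in> U j" and "i \<le> j" and F: "F \<in> n_faces n A"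
    and sub: "F \<subseteq> closure (cell_dom B)"
  shows "F \<in> n_faces n B"
proof -
  obtain m where j: "j = i + m" using \<open>i \<le> j\<close> le_Suc_ex by blast
  obtain X where X: "X \<in> U i" "B \<in> uniform_mesh R {X} m"
    using ancestor B j by blast
  have cA: "is_cell A" and cX: "is_cell X" and cB: "is_cell B"
    using A X(1) B by (auto intro: cell_U)
  obtain x where x: "x \<in> F" using n_faces_nonempty[OF cA F] by blast
  have FX: "F \<subseteq> closure (cell_dom X)" using sub closure_descendant_subset[OF X] by blast
  have F': "F \<in> n_faces n X"
  proof (cases "A = X")
    case False
    obtain h H where H: "H \<in> n_faces h A" "H \<in> n_faces h X"
      "closure H = closure (cell_dom A) \<inter> closure (cell_dom X)"
      by (rule U_conforming[OF A X(1) False, of x]) (use x FX n_faces_subset[OF cA F] in blast)+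
    have "F \<subseteq> closure H" using FX H(3) n_faces_subset[OF cA F] by blast
    then show ?thesis
      by (rule n_faces_common_subset_face[OF cA cX H(1,2) refl F])
  qed (use F in simp)
  have "x \<in> closure (cell_dom B)" "x \<in> closure F"
    using x sub closure_subset by blast+
  then obtain k g where g: "g \<in> n_faces k B" "closure (cell_dom B) \<inter> closure F = closure g"
    using descendant_inter_face[OF X(1) F' X(2)] by blast
  have "closure F \<subseteq> closure (cell_dom B)"
    using sub by (simp add: closure_minimal)
  then have "closure F = closure g" using g(2) by blast
  then show ?thesis
    using n_faces_closure_eq[OF cX cB F' g(1)] g(1) by simp
qed

end

section \<open>Balanced forest meshes\<close>

lemma open_meets_closure:
  assumes "open S" "x \<in> S" "x \<in> closure T" shows "S \<inter> T \<noteq> {}"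
  by (metis assms open_Int_closure_eq_empty disjoint_iff)

text \<open>Distinct open faces of one cell are disjoint, so the definite description in
  \<open>owner_in\<close> is well defined for nonempty \<open>F\<close>.\<close>

lemma owner_in_eq:
  assumes X: "is_cell X" and G: "G \<in> n_faces n X" and F: "F \<subseteq> G" "F \<noteq> {}"
  shows "owner_in X F = G"
  unfolding owner_in_def
proof (rule the_equality)
  have "n < DIM('a) \<or> G = cell_dom X"
    using n_faces_eq_cell_dom(1,2)[OF X G] by linarith
  then have "G \<in> insert (cell_dom X) (vefs X)"
    unfolding insert_iff vefs_iff using G by blast
  then show "G \<in> insert (cell_dom X) (vefs X) \<and> F \<subseteq> G"
    using F(1) by simp
next
  fix H assume H: "H \<in> insert (cell_dom X) (vefs X) \<and> F \<subseteq> H"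
  have "\<exists>m. H \<in> n_faces m X"
  proof (cases "H = cell_dom X")
    case True
    then show ?thesis using cell_dom_in_n_faces[OF X] by blast
  next
    case False
    then have "H \<in> vefs X" using H by simp
    then show ?thesis unfolding vefs_iff by blast
  qed
  then obtain m where m: "H \<in> n_faces m X" ..
  obtain x where "x \<in> F" using F by blast
  then have x: "x \<in> G" "x \<in> H" using F H by auto
  then have xc: "x \<in> closure G" "x \<in> closure H" by (auto intro: closure_subset[THEN subsetD])
  show "H = G"
    by (rule n_faces_meet(4)[OF X m G x(2) xc(1) n_faces_meet(3)[OF X G m x(1) xc(2)]])
qed

text \<open>If \<open>H\<close> had dimension 0 then \<open>W = H\<close> would be a vertex of \<open>K\<close>.\<close>

lemma coarse_cell_face:
  fixes K :: "'a::euclidean_space cell"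
  assumes A: "is_cell A" and K: "is_cell K" and W: "W \<in> n_faces n A" "W \<subseteq> closure (cell_dom K)"
    "W \<notin> vefs K" and x: "x \<in> W" "x \<notin> cell_dom K"
  obtains m H where "H \<in> n_faces m K" "x \<in> H" "max 1 n \<le> m" "m < DIM('a)"
proof -
  have "x \<in> closure (cell_dom K)" using x W by blast
  then obtain m H where H: "H \<in> n_faces m K" "x \<in> H" by (rule n_faces_cover[OF K])
  have nm: "n \<le> m" by (rule n_faces_dim_le[OF A K W(1) H(1) W(2) x(1) H(2)])
  have "m \<noteq> DIM('a)" using n_faces_eq_cell_dom(2)[OF K H(1)] H(2) x(2) by blast
  then have md: "m < DIM('a)" using n_faces_eq_cell_dom(1)[OF K H(1)] by simp
  have "m \<noteq> 0"
  proof
    assume m: "m = 0"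
    then have "H = {x}" using n_faces_0_singleton[OF K _ H(2)] H(1) by simp
    moreover have "W = {x}" using n_faces_0_singleton[OF A _ x(1)] W(1) m nm by simp
    ultimately have "W \<in> vefs K" unfolding vefs_iff using H(1) md by metis
    then show False using W(3) by simp
  qed
  then show ?thesis using that[OF H] nm md by simp
qed

context forest
begin

section \<open>Leaves as a partition of the domain\<close>

lemma children_partition:
  assumes "X \<in> U l"
  shows "finite (R X)" "pairwise (\<lambda>K K'. disjnt (cell_dom K) (cell_dom K')) (R X)"
    "(\<Union>K\<in>R X. closure (cell_dom K)) = closure (cell_dom X)"
  using refinement[OF assms] unfolding refinement_of_def mesh_of_def by blast+

lemma forest_mesh_partition:
  assumes "forest_mesh R C T"
  shows "finite T \<and> T \<subseteq> tree_cells R C \<and>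
    pairwise (\<lambda>K K'. disjnt (cell_dom K) (cell_dom K')) T \<and>
    (\<Union>K\<in>T. closure (cell_dom K)) = closure \<Omega>"
  using assms
proof induction
  case initial
  have "mesh_of \<Omega> C" using mesh_U[of 0] by simp
  moreover have "C \<subseteq> tree_cells R C" unfolding tree_cells_def using UN_upper[of 0 UNIV U] by simp
  ultimately show ?case unfolding mesh_of_def by simp
next
  case (refining T K)
  then obtain l where l: "K \<in> U l" unfolding tree_cells_def by blast
  note ch = children_partition[OF l]
  have "R K \<subseteq> tree_cells R C" using child_U[OF l] unfolding tree_cells_def by blast
  moreover have "disjnt (cell_dom A) (cell_dom B)" if "A \<in> T - {K}" "B \<in> R K" for A B
  proof -
    have "disjnt (cell_dom A) (cell_dom K)"
      using that(1) refining by (auto dest: pairwiseD)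
    then show ?thesis
      using child_subset[OF l that(2)] by (rule disjnt_subset2)
  qed
  note new_old = this
  have "pairwise (\<lambda>K K'. disjnt (cell_dom K) (cell_dom K')) (T - {K} \<union> R K)"
  proof (rule pairwiseI)
    fix A B assume AB: "A \<in> T - {K} \<union> R K" "B \<in> T - {K} \<union> R K" "A \<noteq> B"
    have "disjnt (cell_dom A) (cell_dom B)" if "A \<in> T" "B \<in> T"
      using that AB(3) refining by (auto dest: pairwiseD)
    moreover have "disjnt (cell_dom A) (cell_dom B)" if "A \<in> R K" "B \<in> R K"
      using that AB(3) ch(2) by (auto dest: pairwiseD)
    ultimately show "disjnt (cell_dom A) (cell_dom B)"
      using AB(1,2) new_old[of A B] new_old[of B A] disjnt_sym[of "cell_dom B" "cell_dom A"] by blast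
  qed
  moreover have "(\<Union>K\<in>T - {K} \<union> R K. closure (cell_dom K)) = (\<Union>K\<in>T. closure (cell_dom K))"
  proof -
    have "(\<Union>K\<in>T. closure (cell_dom K)) =
        (\<Union>K\<in>T - {K}. closure (cell_dom K)) \<union> closure (cell_dom K)"
      using refining(2) by auto
    then show ?thesis using ch(3) by (simp add: UN_Un)
  qed
  moreover have "finite (T - {K} \<union> R K)" using refining ch(1) by simp
  moreover have "T - {K} \<union> R K \<subseteq> tree_cells R C"
    using refining \<open>R K \<subseteq> tree_cells R C\<close> by blast
  ultimately show ?case using refining by simp
next
  case (coarsening T K)
  then obtain l where l: "K \<in> U l" unfolding tree_cells_def by blast
  note ch = children_partition[OF l]
  \<comment> \<open>The closures of the children cover \<open>K\<close>. An open leaf meeting such a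
    closure meets the child itself, which is a leaf, so \<open>A\<close> would be that
    child.\<close>
  have "disjnt (cell_dom A) (cell_dom K)" if A: "A \<in> T - R K" for A
  proof (rule ccontr)
    assume "\<not> disjnt (cell_dom A) (cell_dom K)"
    then obtain y where y: "y \<in> cell_dom A" "y \<in> cell_dom K" by (auto simp: disjnt_def)
    then obtain c where c: "c \<in> R K" "y \<in> closure (cell_dom c)"
      using ch(3) closure_subset by blast
    obtain i where "A \<in> U i" using A coarsening unfolding tree_cells_def by blast
    then have "open (cell_dom A)" using cell_U open_cell_dom by blast
    then have "cell_dom A \<inter> cell_dom c \<noteq> {}"
      using y(1) c(2) by (rule open_meets_closure)
    moreover have "A \<in> T" "c \<in> T" using A c(1) coarsening by auto
    ultimately have "A = c" using coarsening by (meson disjnt_def pairwiseD)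
    then show False using A c by blast
  qed
  note new_old = this
  have "pairwise (\<lambda>K K'. disjnt (cell_dom K) (cell_dom K')) (insert K (T - R K))"
  proof (rule pairwiseI)
    fix A B assume AB: "A \<in> insert K (T - R K)" "B \<in> insert K (T - R K)" "A \<noteq> B"
    have "disjnt (cell_dom A) (cell_dom B)" if "A \<in> T" "B \<in> T"
      using that AB(3) coarsening by (auto dest: pairwiseD)
    then show "disjnt (cell_dom A) (cell_dom B)"
      using AB new_old[of A] new_old[of B] disjnt_sym[of "cell_dom B" "cell_dom A"] by blast
  qed
  moreover have "(\<Union>K\<in>insert K (T - R K). closure (cell_dom K)) = (\<Union>K\<in>T. closure (cell_dom K))"
  proof -
    have "T = (T - R K) \<union> R K" using coarsening by blast
    then have "(\<Union>K\<in>T. closure (cell_dom K)) =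
        (\<Union>K\<in>T - R K. closure (cell_dom K)) \<union> (\<Union>K\<in>R K. closure (cell_dom K))"
      by (metis UN_Un)
    then show ?thesis using ch(3) by (simp add: Un_commute)
  qed
  moreover have "finite (insert K (T - R K))" using coarsening by simp
  moreover have "insert K (T - R K) \<subseteq> tree_cells R C" using coarsening by blast
  ultimately show ?case using coarsening by simp
qed

end

locale balanced_forest = forest +
  fixes T :: "'a cell set" and k :: nat
  assumes T_forest_mesh: "forest_mesh R C T" and T_balanced: "balanced R C T k"
begin

abbreviation "lv \<equiv> level R C"

lemma T_U: "K \<in> T \<Longrightarrow> K \<in> U (lv K)"
  using forest_mesh_partition[OF T_forest_mesh] level_U unfolding tree_cells_def by blast

lemma T_cell: "K \<in> T \<Longrightarrow> is_cell K"
  using T_U cell_U by blast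

lemma T_overlap: "K \<in> T \<Longrightarrow> K' \<in> T \<Longrightarrow> cell_dom K \<inter> cell_dom K' \<noteq> {} \<Longrightarrow> K = K'"
  using forest_mesh_partition[OF T_forest_mesh] unfolding pairwise_def disjnt_def by blast

lemma T_interior:
  assumes "K \<in> T" "K' \<in> T" "x \<in> cell_dom K" "x \<in> closure (cell_dom K')" shows "K = K'"
  using T_overlap[OF assms(1,2)] open_meets_closure[OF open_cell_dom[OF T_cell[OF assms(1)]] assms(3,4)]
  by blast

text \<open>The other children may have been refined further, but no leaf overlapping
  \<open>X\<close> has level at most \<open>l\<close>: it would contain \<open>X\<close>, hence
  overlap and equal the leaf \<open>K1\<close> of level \<open>l + 1\<close>.\<close>

lemma split_cell_covered:
  assumes X: "X \<in> U l" and K1: "K1 \<in> R X" "K1 \<in> T" and x: "x \<in> closure (cell_dom X)"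
  obtains K where "K \<in> T" "l < lv K" "x \<in> closure (cell_dom K)"
proof -
  note T = forest_mesh_partition[OF T_forest_mesh]
  define B where "B = {K \<in> T. cell_dom X \<inter> cell_dom K \<noteq> {}}"
  \<comment> \<open>Openness of \<open>cell_dom X\<close> ensures that every leaf whose closure
    reaches a point of it overlaps \<open>X\<close>; finiteness of \<open>B\<close> then extends the
    cover to the closure.\<close>
  have "cell_dom X \<subseteq> (\<Union>K\<in>B. closure (cell_dom K))"
  proof
    fix y assume y: "y \<in> cell_dom X"
    have "cell_dom X \<subseteq> \<Omega>" using mesh_U[of l] X unfolding mesh_of_def by blast
    then have "y \<in> closure \<Omega>" using y closure_subset by blast
    then obtain K where K: "K \<in> T" "y \<in> closure (cell_dom K)" using T by blast
    then have "K \<in> B"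
      unfolding B_def using open_meets_closure[OF open_cell_dom[OF cell_U[OF X]] y] by blast
    with K show "y \<in> (\<Union>K\<in>B. closure (cell_dom K))" by blast
  qed
  moreover have "closed (\<Union>K\<in>B. closure (cell_dom K))"
    using T by (intro closed_UN) (auto simp: B_def)
  ultimately have "closure (cell_dom X) \<subseteq> (\<Union>K\<in>B. closure (cell_dom K))"
    by (rule closure_minimal)
  then obtain K where K: "K \<in> B" "x \<in> closure (cell_dom K)" using x by blast
  then have KT: "K \<in> T" by (simp add: B_def)
  have "l < lv K"
  proof (rule ccontr)
    assume "\<not> l < lv K"
    then obtain m where l: "l = lv K + m" using le_Suc_ex not_less by blast
    then obtain Y where Y: "Y \<in> U (lv K)" "X \<in> uniform_mesh R {Y} m"
      using ancestor X by blast
    have XY: "cell_dom X \<subseteq> cell_dom Y" using Y by (rule descendant_subset)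
    then have "Y = K"
      using U_overlap[OF Y(1) T_U[OF KT]] K(1) unfolding B_def by blast
    then have "cell_dom K1 \<subseteq> cell_dom K"
      using XY child_subset[OF X K1(1)] by blast
    then have "K1 = K"
      using T_overlap[OF K1(2) KT] cell_dom_nonempty[OF T_cell[OF K1(2)]] by blast
    then show False
      using level_U[OF child_U[OF X K1(1)]] l by simp
  qed
  then show ?thesis using that KT K(2) by blast
qed

text \<open>Compare \<open>K\<close> with the ancestor \<open>X\<close> of \<open>K'\<close> on its
  level. They share a closed face \<open>closure H\<close>, which \<open>K'\<close> cuts in
  \<open>closure g\<close>. The face \<open>Z\<close> of \<open>X\<close> containing
  \<open>g\<close> meets \<open>closure H\<close>, so it lies there and is a face of
  \<open>K\<close> too.\<close>

lemma finer_neighbor: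
  assumes K: "K \<in> T" "K' \<in> T" "lv K < lv K'"
    and x: "x \<in> closure (cell_dom K)" "x \<in> closure (cell_dom K')"
  obtains n Z where "n < DIM('a)" "Z \<in> n_faces n K" "x \<in> closure Z" "neighbor T K Z K'"
proof -
  note cK = T_cell[OF K(1)] and cK' = T_cell[OF K(2)]
  obtain m where m: "lv K' = lv K + m" using K(3) le_Suc_ex less_imp_le by blast
  obtain X where X: "X \<in> U (lv K)" "K' \<in> uniform_mesh R {X} m"
    using ancestor T_U[OF K(2)] m by metis
  note cX = cell_U[OF X(1)]
  have KX: "K \<noteq> X"
  proof
    assume "K = X"
    then have "K' = K"
      using T_overlap[OF K(2,1)] descendant_subset[OF X] cell_dom_nonempty[OF cK'] by blast
    then show False using K(3) by simp
  qed
  have clX: "closure (cell_dom K') \<subseteq> closure (cell_dom X)"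
    using X by (rule closure_descendant_subset)
  then have xX: "x \<in> closure (cell_dom X)" using x by blast
  obtain h H where H: "h < DIM('a)" "H \<in> n_faces h K" "H \<in> n_faces h X"
    "closure H = closure (cell_dom K) \<inter> closure (cell_dom X)"
    using U_conforming[OF T_U[OF K(1)] X(1) KX x(1) xX] .
  have xH: "x \<in> closure H" using H(4) x(1) xX by blast
  obtain j g where g: "g \<in> n_faces j K'" "closure (cell_dom K') \<inter> closure H = closure g"
    using descendant_inter_face[OF X(1) H(3) X(2) x(2) xH] by blast
  obtain n Z where Z: "Z \<in> n_faces n X" "g \<subseteq> Z"
    using descendant_face_in_face[OF X g(1)] by blast
  obtain y where y: "y \<in> g" using n_faces_nonempty[OF cK' g(1)] by blast
  then have yZ: "y \<in> Z" and yH: "y \<in> closure H"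
    using Z(2) g(2) closure_subset by blast+
  have ZH: "Z \<subseteq> closure H" and nh: "n \<le> h"
    using n_faces_meet(1,3)[OF cX Z(1) H(3) yZ yH] by simp_all
  have ZK: "Z \<in> n_faces n K"
    by (rule n_faces_common_subset_face[OF cX cK H(3,2) refl Z(1) ZH])
  have "g \<subseteq> closure (cell_dom K)" using Z(2) ZH H(4) by blast
  \<comment> \<open>\<open>neighbor\<close> asks for a VEF of \<open>K'\<close>, so the dimension of
    \<open>g\<close> must stay below \<open>d\<close>.\<close>
  then have "j \<le> n"
    by (rule n_faces_dim_le[OF cK' cK g(1) ZK _ y yZ])
  then have vg: "g \<in> vefs K'" using g(1) nh H(1) unfolding vefs_iff by (meson le_less_trans)
  have vZ: "Z \<in> vefs K" using ZK nh H(1) unfolding vefs_iff by (meson le_less_trans)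
  have gZ: "closure g \<subseteq> closure Z" using Z(2) by (rule closure_mono)
  have "closure (cell_dom K) \<inter> closure (cell_dom K') = closure g"
    using g(2) H(4) clX by blast
  then have "closure Z \<inter> closure g = closure (cell_dom K) \<inter> closure (cell_dom K')"
    using gZ by blast
  moreover have "Z = g \<or> g \<subset> Z" using Z(2) by blast
  moreover have "K' \<in> T - {K}" using K by auto
  ultimately have "neighbor T K Z K'"
    unfolding neighbor_def using K(1) vZ vg by blast
  moreover have "x \<in> closure Z" using gZ g(2) x(2) xH by blast
  moreover have "n < DIM('a)" using nh H(1) by simp
  ultimately show ?thesis using that ZK by blast
qed

text \<open>The closure of the neighbor face contains \<open>x\<close> and hence \<open>H\<close>,
  which bounds its dimension from below as balance requires.\<close>

lemma finer_neighbor_dim: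
  assumes K: "K \<in> T" "K' \<in> T" "lv K < lv K'"
    and x: "x \<in> closure (cell_dom K')" and H: "H \<in> n_faces n K" "x \<in> H"
  obtains m Z where "n \<le> m" "m < DIM('a)" "Z \<in> n_faces m K" "neighbor T K Z K'"
proof -
  note cK = T_cell[OF K(1)]
  have "x \<in> closure (cell_dom K)" using n_faces_subset[OF cK H(1)] H(2) by blast
  then obtain m Z where Z: "m < DIM('a)" "Z \<in> n_faces m K" "x \<in> closure Z" "neighbor T K Z K'"
    using finer_neighbor[OF K _ x] by blast
  show ?thesis
    by (rule that[OF n_faces_meet(3)[OF cK H(1) Z(2) H(2) Z(3)] Z(1,2,4)])
qed

lemma level_le_Suc:
  assumes K: "K \<in> T" "K' \<in> T" and x: "x \<in> closure (cell_dom K')"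
    and H: "H \<in> n_faces n K" "x \<in> H" "k \<le> n"
  shows "lv K' \<le> Suc (lv K)"
proof (rule ccontr)
  assume *: "\<not> lv K' \<le> Suc (lv K)"
  then have "lv K < lv K'" by simp
  then obtain m Z where Z: "n \<le> m" "m < DIM('a)" "Z \<in> n_faces m K" "neighbor T K Z K'"
    using finer_neighbor_dim[OF K _ x H(1,2)] by blast
  then have "k \<le> m" using H(3) by simp
  then have "\<not> \<bar>int (lv K') - int (lv K)\<bar> > 1"
    using T_balanced K(1) Z(2-4) unfolding balanced_def by blast
  then show False using * by simp
qed

text \<open>By \<open>face_inherited\<close>, a leaf containing \<open>W\<close> without having it
  as a VEF is coarser than \<open>X\<close>, while some leaf at a point of \<open>W\<close> is finer
  than \<open>X\<close>. A gap of two levels contradicts balance.\<close>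

lemma split_cell_face_regular:
  assumes X: "X \<in> U l" and K1: "K1 \<in> R X" "K1 \<in> T" and W: "W \<in> n_faces n X" "n < DIM('a)"
    and k: "k \<le> max 1 n" and K: "K \<in> T" "W \<subseteq> closure (cell_dom K)"
  shows "W \<in> vefs K"
proof (rule ccontr)
  assume not: "W \<notin> vefs K"
  note cX = cell_U[OF X] and cK = T_cell[OF K(1)]
  have lvK: "lv K < l"
  proof (rule ccontr)
    assume "\<not> lv K < l"
    then have "W \<in> n_faces n K"
      using face_inherited[OF X T_U[OF K(1)] _ W(1) K(2)] by simp
    then show False using not W(2) unfolding vefs_iff by blast
  qed
  obtain x where x: "x \<in> W" using n_faces_nonempty[OF cX W(1)] by blast
  then have "x \<in> closure (cell_dom X)" using n_faces_subset[OF cX W(1)] by blast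
  then obtain K3 where K3: "K3 \<in> T" "l < lv K3" "x \<in> closure (cell_dom K3)"
    by (rule split_cell_covered[OF X K1])
  \<comment> \<open>This makes the face of \<open>K\<close> through \<open>x\<close> a VEF instead
    of the open cell.\<close>
  have "x \<notin> cell_dom K"
    using T_interior[OF K(1) K3(1) _ K3(3)] K3(2) lvK by auto
  then obtain m H where H: "H \<in> n_faces m K" "x \<in> H" "max 1 n \<le> m"
    using coarse_cell_face[OF cX cK W(1) K(2) not x] by blast
  have "lv K3 \<le> Suc (lv K)"
    by (rule level_le_Suc[OF K(1) K3(1,3) H(1,2) le_trans[OF k H(3)]])
  then show False using K3(2) lvK by simp
qed

text \<open>A cell at least as fine as \<open>K\<close> would inherit \<open>F\<close>, and balance
  limits the gap to one level. The last conclusion views the neighbor relation from the coarse side,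
  as \<open>ghost_cells\<close> permits.\<close>

lemma hanging_level:
  assumes K: "K \<in> T" "F \<in> n_faces n K" "n < DIM('a)"
    and K': "K' \<in> T" "F \<subseteq> closure (cell_dom K')" "F \<notin> vefs K'"
  shows "lv K' < lv K" "k \<le> max 1 n \<Longrightarrow> lv K = Suc (lv K')"
    "\<exists>m Z. max 1 n \<le> m \<and> m < DIM('a) \<and> Z \<in> n_faces m K' \<and> neighbor T K' Z K"
proof -
  note cK = T_cell[OF K(1)] and cK' = T_cell[OF K'(1)]
  show lt: "lv K' < lv K"
  proof (rule ccontr)
    assume "\<not> lv K' < lv K"
    then have "F \<in> n_faces n K'"
      using face_inherited[OF T_U[OF K(1)] T_U[OF K'(1)] _ K(2) K'(2)] by simp
    then show False using K(3) K'(3) unfolding vefs_iff by blast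
  qed
  obtain x where x: "x \<in> F" using n_faces_nonempty[OF cK K(2)] by blast
  then have xK: "x \<in> closure (cell_dom K)" using n_faces_subset[OF cK K(2)] by blast
  have "x \<notin> cell_dom K'"
    using T_interior[OF K'(1) K(1) _ xK] lt by auto
  then obtain m H where H: "H \<in> n_faces m K'" "x \<in> H" "max 1 n \<le> m"
    using coarse_cell_face[OF cK cK' K(2) K'(2,3) x] by blast
  show "lv K = Suc (lv K')" if "k \<le> max 1 n"
  proof -
    have "lv K \<le> Suc (lv K')"
      by (rule level_le_Suc[OF K'(1) K(1) xK H(1,2) le_trans[OF that H(3)]])
    then show ?thesis using lt by simp
  qed
  obtain i Z where "m \<le> i" "i < DIM('a)" "Z \<in> n_faces i K'" "neighbor T K' Z K"
    using finer_neighbor_dim[OF K'(1) K(1) lt xK H(1,2)] .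
  then show "\<exists>m Z. max 1 n \<le> m \<and> m < DIM('a) \<and> Z \<in> n_faces m K' \<and> neighbor T K' Z K"
    using H(3) le_trans by blast
qed

lemma owner_wrtE:
  assumes "owner_wrt R C T F X G"
  obtains l K n m where "X \<in> U l" "K \<in> R X" "K \<in> T" "F \<in> n_faces n K" "n < DIM('a)"
    "G \<in> n_faces m X" "F \<subseteq> G"
proof -
  obtain K l where X: "X \<in> U l" and K: "K \<in> R X" "K \<in> T" "F \<in> vefs K" and G: "G = owner_in X F"
    using assms unfolding owner_wrt_def cells_at_def tree_cells_def by blast
  then obtain n where n: "F \<in> n_faces n K" "n < DIM('a)" unfolding vefs_iff by blast
  obtain m G' where G': "G' \<in> n_faces m X" "F \<subseteq> G'"
    using child_face_in_face[OF X K(1) n(1)] .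
  have "G = G'"
    unfolding G using cell_U[OF X] G' n_faces_nonempty[OF T_cell[OF K(2)] n(1)]
    by (rule owner_in_eq)
  then show ?thesis using that X K n G' by blast
qed

end

section \<open>Constraining VEFs\<close>

text \<open>The dimension condition that makes balance applicable. A bare point set carries no
  dimension, so all cells having \<open>F\<close> as a face are consulted.\<close>

definition dim_admissible :: "'a::euclidean_space cell set \<Rightarrow> nat \<Rightarrow> 'a set \<Rightarrow> bool" where
  "dim_admissible T k F \<longleftrightarrow> (\<forall>K\<in>T. \<forall>n. F \<in> n_faces n K \<longrightarrow> k \<le> max 1 n)"

lemma dof_owner_dim_admissible:
  assumes "g \<in> global_dofs T V" "k \<le> max 1 (min_dof_dim T V)"
  shows "dim_admissible T k (dof_owner V g)"
  unfolding dim_admissible_def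
proof (intro ballI allI impI)
  fix K n assume "K \<in> T" "dof_owner V g \<in> n_faces n K"
  then have "min_dof_dim T V \<le> n"
    unfolding min_dof_dim_def using assms(1) by (intro Least_le) blast
  then show "k \<le> max 1 n" using assms(2) by linarith
qed

context balanced_forest
begin

text \<open>Balance places \<open>K'\<close> on exactly the level of the parent \<open>X\<close>, so
  conformity of that uniform mesh gives them a common closed face. \<open>G\<close> meets it at a
  point of \<open>F\<close> and is therefore a face of both.\<close>

lemma owner_in_coarse_cell:
  assumes own: "owner_wrt R C T F X G" and F: "dim_admissible T k F"
    and K': "K' \<in> coarse_cells_at T F"
  shows "\<exists>m. m < DIM('a) \<and> G \<in> n_faces m X \<and> G \<in> n_faces m K'"
proof -
  obtain l K n m where X: "X \<in> U l" and K: "K \<in> R X" "K \<in> T"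
    and n: "F \<in> n_faces n K" "n < DIM('a)" and G: "G \<in> n_faces m X" "F \<subseteq> G"
    using own by (rule owner_wrtE)
  have K'T: "K' \<in> T" "F \<subseteq> closure (cell_dom K')" "F \<notin> vefs K'"
    using K' unfolding coarse_cells_at_def by auto
  have "k \<le> max 1 n" using F K(2) n(1) unfolding dim_admissible_def by blast
  then have "level R C K = Suc (level R C K')"
    by (rule hanging_level(2)[OF K(2) n K'T])
  moreover have "level R C K = Suc l" using level_U[OF child_U[OF X K(1)]] .
  ultimately have K'U: "K' \<in> U l" using T_U[OF K'T(1)] by simp
  note cX = cell_U[OF X] and cK' = cell_U[OF K'U] and cK = T_cell[OF K(2)]
  have "X \<noteq> K'"
  proof
    assume "X = K'"
    then have "K = K'"
      using T_overlap[OF K(2) K'T(1)] child_subset[OF X K(1)] cell_dom_nonempty[OF cK] by blast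
    then show False using K'T(3) n unfolding vefs_iff by blast
  qed
  obtain x where x: "x \<in> F" using n_faces_nonempty[OF cK n(1)] by blast
  then have xG: "x \<in> G" and xK': "x \<in> closure (cell_dom K')"
    using G(2) K'T(2) by blast+
  then have xX: "x \<in> closure (cell_dom X)"
    using n_faces_subset[OF cX G(1)] by blast
  obtain h H where H: "h < DIM('a)" "H \<in> n_faces h X" "H \<in> n_faces h K'"
    "closure H = closure (cell_dom X) \<inter> closure (cell_dom K')"
    using U_conforming[OF X K'U \<open>X \<noteq> K'\<close> xX xK'] .
  have xH: "x \<in> closure H" using H(4) xX xK' by blast
  have "m \<le> h" "G \<subseteq> closure H"
    using n_faces_meet(3,1)[OF cX G(1) H(2) xG xH] by simp_all
  then have "m < DIM('a)" "G \<in> n_faces m K'"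
    using H(1) n_faces_common_subset_face[OF cX cK' H(2,3) refl G(1)] by simp_all
  with G(1) show ?thesis by blast
qed

lemma constraint_vef_in_coarse_cell:
  assumes own: "owner_wrt R C T F X G" and F: "dim_admissible T k F"
    and K': "K' \<in> coarse_cells_at T F" and W: "W \<in> insert G (boundary_vefs X G)"
  shows "W \<in> vefs X" "W \<in> vefs K'"
proof -
  obtain m where m: "m < DIM('a)" "G \<in> n_faces m X" "G \<in> n_faces m K'"
    using owner_in_coarse_cell[OF own F K'] by blast
  obtain l where X: "X \<in> U l" using own by (rule owner_wrtE)
  have "is_cell K'" using K' T_cell unfolding coarse_cells_at_def by blast
  then have common: "W \<in> n_faces n K'" if "W \<in> n_faces n X" "W \<subseteq> closure G" for n
    using n_faces_common_subset_face[OF cell_U[OF X] _ m(2,3) refl that] by blast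
  have WG: "W \<subseteq> closure G" using W closure_subset unfolding boundary_vefs_def by blast
  show WX: "W \<in> vefs X"
    using W m(1,2) unfolding boundary_vefs_def vefs_iff by blast
  show "W \<in> vefs K'"
    using WX common[OF _ WG] unfolding vefs_iff by blast
qed

text \<open>The owner relation supplies a leaf child of \<open>X\<close>; the leaf \<open>K\<close>
  ties the admissible dimension of \<open>W\<close> to its dimension in \<open>X\<close>.\<close>

lemma split_cell_face_not_hanging:
  assumes own: "owner_wrt R C T F X G" and W: "W \<in> vefs X" and n: "dim_admissible T k W"
    and K: "K \<in> T" "W \<in> vefs K"
  shows "coarse_cells_at T W = {}"
proof (rule ccontr)
  assume "coarse_cells_at T W \<noteq> {}"
  then obtain K' where K': "K' \<in> T" "W \<notin> vefs K'" "W \<subseteq> closure (cell_dom K')"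
    unfolding coarse_cells_at_def by blast
  obtain l K1 where X: "X \<in> U l" "K1 \<in> R X" "K1 \<in> T"
    using own by (rule owner_wrtE)
  obtain i where i: "W \<in> n_faces i X" "i < DIM('a)" using W unfolding vefs_iff by blast
  obtain j where j: "W \<in> n_faces j K" using K(2) unfolding vefs_iff by blast
  have "i = j" using n_faces_closure_eq(1)[OF cell_U[OF X(1)] T_cell[OF K(1)] i(1) j refl] .
  then have "k \<le> max 1 i" using n K(1) j unfolding dim_admissible_def by blast
  then have "W \<in> vefs K'"
    by (rule split_cell_face_regular[OF X i _ K'(1,3)])
  then show False using K'(2) by simp
qed

text \<open>The coarse cell has \<open>W\<close> as a VEF, so \<open>W\<close> is global; as a VEF
  of the refined parent it cannot hang.\<close>

lemma constraint_vef_regular: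
  assumes own: "owner_wrt R C T F X G" and F: "dim_admissible T k F"
    and W: "W \<in> insert G (boundary_vefs X G)" "dim_admissible T k W"
  shows "W \<in> regular_vefs T"
proof -
  have "F \<in> hanging_vefs T" using own by (simp add: owner_wrt_def)
  then obtain K' where K': "K' \<in> coarse_cells_at T F" unfolding hanging_vefs_def by blast
  then have "K' \<in> T" by (simp add: coarse_cells_at_def)
  note WX = constraint_vef_in_coarse_cell[OF own F K' W(1)]
  have "coarse_cells_at T W = {}"
    using split_cell_face_not_hanging[OF own WX(1) W(2) \<open>K' \<in> T\<close> WX(2)] .
  moreover have "W \<in> global_vefs T"
    using \<open>K' \<in> T\<close> WX(2) unfolding global_vefs_def by blast
  ultimately show ?thesis by (simp add: regular_vefs_def)
qed

section \<open>Processor-local VEFs and ghost cells\<close>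

lemma proc_cells_subset: "proc_cells T s proc p \<subseteq> T"
  by (auto simp: proc_cells_def local_cells_def ghost_cells_def)

text \<open>If \<open>K'\<close> is not local, it is a ghost: the large enough neighbor face belongs
  to \<open>K'\<close>, which is the second alternative in \<open>ghost_cells\<close>.\<close>

lemma coarse_cell_in_proc_cells:
  assumes K: "K \<in> local_cells T proc p" "F \<in> vefs K" and K': "K' \<in> coarse_cells_at T F"
    and F: "dim_admissible T k F"
  shows "K' \<in> proc_cells T k proc p"
proof (cases "K' \<in> local_cells T proc p")
  case True
  then show ?thesis by (simp add: proc_cells_def)
next
  case False
  have KT: "K \<in> T" using K(1) by (simp add: local_cells_def)
  have K'T: "K' \<in> T" "F \<subseteq> closure (cell_dom K')" "F \<notin> vefs K'"
    using K' unfolding coarse_cells_at_def by auto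
  obtain n where n: "F \<in> n_faces n K" "n < DIM('a)" using K(2) unfolding vefs_iff by blast
  have "k \<le> max 1 n" using F KT n(1) unfolding dim_admissible_def by blast
  moreover obtain m Z where Z: "max 1 n \<le> m" "m < DIM('a)" "Z \<in> n_faces m K'" "neighbor T K' Z K"
    using hanging_level(3)[OF KT n K'T] by blast
  ultimately have "k \<le> m" by linarith
  then have "K' \<in> ghost_cells T k proc p"
    unfolding ghost_cells_def using False K'T(1) K(1) Z(2-4) by blast
  then show ?thesis by (simp add: proc_cells_def)
qed

lemma hanging_proc_local_vef_coarse_cell:
  assumes "F \<in> proc_local_vefs R C T k proc p"
    and hang: "F \<in> hanging_vefs T" and F: "dim_admissible T k F"
  shows "\<exists>K'\<in>proc_cells T k proc p. K' \<in> coarse_cells_at T F"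
proof -
  obtain K' where K': "K' \<in> coarse_cells_at T F" using hang unfolding hanging_vefs_def by blast
  obtain K where K: "K \<in> T" "F \<in> vefs K"
    using hang unfolding hanging_vefs_def global_vefs_def by blast
  show ?thesis
    using assms(1)
  proof cases
    case touching
    then obtain K1 where "K1 \<in> local_cells T proc p" "F \<in> vefs K1"
      unfolding cells_at_def by blast
    then have "K' \<in> proc_cells T k proc p"
      using K' F by (rule coarse_cell_in_proc_cells)
    then show ?thesis using K' by blast
  next
    case coarse
    then show ?thesis by blast
  next
    case (owner F' X)
    \<comment> \<open>An owner could be the parent's own domain; the dimension of \<open>F\<close>
      in the leaf \<open>K\<close> rules this out. As a VEF of a refined cell, \<open>F\<close> then
      cannot hang.\<close>
    then have "F \<in> vefs X"
    proof -
      obtain l m where X: "X \<in> U l" "F \<in> n_faces m X" using owner(4) by (rule owner_wrtE)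
      obtain n where n: "F \<in> n_faces n K" "n < DIM('a)" using K(2) unfolding vefs_iff by blast
      have "m = n" using n_faces_closure_eq(1)[OF cell_U[OF X(1)] T_cell[OF K(1)] X(2) n(1) refl] .
      then show ?thesis using X(2) n(2) unfolding vefs_iff by blast
    qed
    then have "coarse_cells_at T F = {}"
      by (rule split_cell_face_not_hanging[OF owner(4) _ F K])
    then show ?thesis using K' by simp
  next
    case (bdry G F' X)
    obtain K6 where K6: "K6 \<in> proc_cells T k proc p" "G \<in> vefs K6"
      using bdry(3) unfolding proc_vefs_def by blast
    then have K6T: "K6 \<in> T" using proc_cells_subset by blast
    obtain n where n: "G \<in> n_faces n K6" "n < DIM('a)" using K6(2) unfolding vefs_iff by blast
    have FG: "F \<subseteq> closure G" using bdry(7) by blast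
    \<comment> \<open>Otherwise \<open>F\<close> would be a subface of the common face
      \<open>G\<close>, hence a VEF of the refined cell \<open>X\<close> and not hanging. So the
      stored cell \<open>K6\<close> is itself a coarse cell at \<open>F\<close>.\<close>
    have "F \<notin> vefs K6"
    proof
      assume FK6: "F \<in> vefs K6"
      then obtain i where i: "F \<in> n_faces i K6" "i < DIM('a)" unfolding vefs_iff by blast
      obtain l m where X: "X \<in> U l" "G \<in> n_faces m X" using bdry(6) by (rule owner_wrtE)
      have "F \<in> n_faces i X"
        by (rule n_faces_common_subset_face[OF T_cell[OF K6T] cell_U[OF X(1)] n(1) X(2) refl i(1) FG])
      then have "F \<in> vefs X" using i(2) unfolding vefs_iff by blast
      then have "coarse_cells_at T F = {}"
        by (rule split_cell_face_not_hanging[OF bdry(6) _ F K])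
      then show False using K' by simp
    qed
    moreover have "F \<subseteq> closure (cell_dom K6)"
      using FG n_faces_closure_subset[OF T_cell[OF K6T] n(1)] by blast
    ultimately have "K6 \<in> coarse_cells_at T F"
      using K6T by (simp add: coarse_cells_at_def)
    then show ?thesis using K6(1) by blast
  qed
qed

text \<open>The processor stores a coarse cell at \<open>F\<close>, and this cell has all
  constraining VEFs. They are then classified by whether a local cell has them as VEFs.\<close>

lemma constraint_vef_proc_local:
  assumes loc: "F \<in> proc_local_vefs R C T k proc p"
    and own: "owner_wrt R C T F X G" and F: "dim_admissible T k F"
    and W: "W \<in> insert G (boundary_vefs X G)"
  shows "W \<in> proc_vefs T k proc p" "W \<in> proc_local_vefs R C T k proc p"
proof -
  have "F \<in> hanging_vefs T" using own by (simp add: owner_wrt_def)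
  then obtain K' where K': "K' \<in> proc_cells T k proc p" "K' \<in> coarse_cells_at T F"
    using hanging_proc_local_vef_coarse_cell[OF loc _ F] by blast
  have in_proc: "Y \<in> proc_vefs T k proc p" if "Y \<in> insert G (boundary_vefs X G)" for Y
    using constraint_vef_in_coarse_cell(2)[OF own F K'(2) that] K'(1)
    unfolding proc_vefs_def by blast
  then show Wp: "W \<in> proc_vefs T k proc p" using W .
  have Gp: "G \<in> proc_vefs T k proc p" using in_proc by blast
  \<comment> \<open>Either rule \<open>touching\<close> applies to \<open>Y\<close>, or the ghost
    premise of the other rules holds.\<close>
  have dich: "Y \<in> proc_local_vefs R C T k proc p \<and>
        (\<exists>K\<in>proc_cells T k proc p. K \<in> local_cells T proc p \<and> Y \<in> vefs K) \<or>
      only_ghost_at T k proc p Y" if "Y \<in> proc_vefs T k proc p" for Y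
  proof (cases "cells_at T Y \<inter> proc_cells T k proc p \<inter> local_cells T proc p = {}")
    case True
    then show ?thesis unfolding only_ghost_at_def proc_cells_def by blast
  next
    case False
    then show ?thesis
      using proc_local_vefs.touching[OF that False] unfolding cells_at_def by blast
  qed
  show "W \<in> proc_local_vefs R C T k proc p"
  proof (rule ccontr)
    assume not: "W \<notin> proc_local_vefs R C T k proc p"
    then have gW: "only_ghost_at T k proc p W" using dich[OF Wp] by blast
    have "W \<noteq> G" using proc_local_vefs.owner[OF Wp gW loc] own not by blast
    then have bd: "W \<in> vefs X" "W \<subseteq> closure G - G"
      using W by (auto simp: boundary_vefs_def)
    \<comment> \<open>Rule \<open>bdry\<close> also needs \<open>G\<close> to be seen by ghost cells
      only. Otherwise a local cell has \<open>G\<close> and thus its subface \<open>W\<close>, so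
      \<open>touching\<close> applies to \<open>W\<close>.\<close>
    have "\<not> only_ghost_at T k proc p G"
      using proc_local_vefs.bdry[OF Wp gW Gp _ loc own bd(2)] not by blast
    then obtain K where K: "K \<in> proc_cells T k proc p" "K \<in> local_cells T proc p" "G \<in> vefs K"
      using dich[OF Gp] by blast
    have KT: "K \<in> T" using K(2) by (simp add: local_cells_def)
    obtain l m where X: "X \<in> U l" "G \<in> n_faces m X" using own by (rule owner_wrtE)
    obtain i where i: "W \<in> n_faces i X" "i < DIM('a)" using bd(1) unfolding vefs_iff by blast
    obtain j where j: "G \<in> n_faces j K" using K(3) unfolding vefs_iff by blast
    have "W \<in> n_faces i K"
      by (rule n_faces_common_subset_face[OF cell_U[OF X(1)] T_cell[OF KT] X(2) j refl i(1)])
        (use bd(2) in blast)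
    then have "K \<in> cells_at T W"
      using KT i(2) unfolding cells_at_def vefs_iff by blast
    then have "cells_at T W \<inter> proc_cells T k proc p \<inter> local_cells T proc p \<noteq> {}"
      using K(1,2) by blast
    then show False
      using proc_local_vefs.touching[OF Wp] not by blast
  qed
qed

end

theorem proposition4p1:
  fixes \<Omega> :: "'a::euclidean_space set"
    and R :: "'a cell \<Rightarrow> 'a cell set"
    and C T :: "'a cell set"
    and V :: "('a, 'v::real_vector, 'w, 'i, 'g) fe_data"
    and proc :: "'a cell \<Rightarrow> nat"
    and k P :: nat
  assumes "k < DIM('a)"
    and "forest_setting \<Omega> R C"
    and "forest_mesh R C T"
    and "balanced R C T k"
    and "\<forall>K\<in>T. proc K \<in> {1..P}"
    and "conforming_fe_space R C T V"
    and "k \<le> max 1 (min_dof_dim T V)"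
  shows "(\<forall>g\<in>hanging_dofs T V. \<forall>g'\<in>constraining_dofs R C T V g. g' \<notin> hanging_dofs T V) \<and>
    (\<forall>p\<in>{1..P}. \<forall>g\<in>global_dofs T V.
       dof_owner V g \<in> hanging_vefs T \<inter> proc_local_vefs R C T k proc p \<longrightarrow>
       dof_owner V g \<in> proc_vefs T k proc p \<and>
       (\<forall>g'\<in>constraining_dofs R C T V g.
          dof_owner V g' \<in> regular_vefs T \<inter> proc_local_vefs R C T k proc p \<and>
          dof_owner V g' \<in> proc_vefs T k proc p))"
proof -
  interpret balanced_forest \<Omega> R C T k
    using assms by unfold_locales
  have adm: "dim_admissible T k (dof_owner V g)" if "g \<in> global_dofs T V" for g
    using that assms(7) by (rule dof_owner_dim_admissible)
  have direct: "dof_owner V g' \<in> regular_vefs T"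
    if g: "g \<in> global_dofs T V" and g': "g' \<in> constraining_dofs R C T V g" for g g'
  proof -
    obtain X G where "owner_wrt R C T (dof_owner V g) X G"
      "dof_owner V g' \<in> insert G (boundary_vefs X G)" and glob: "g' \<in> global_dofs T V"
      using g' unfolding constraining_dofs_def by blast
    then show ?thesis
      using constraint_vef_regular[OF _ adm[OF g] _ adm[OF glob]] by blast
  qed
  have proc_local: "dof_owner V g' \<in> proc_local_vefs R C T k proc p \<and> dof_owner V g' \<in> proc_vefs T k proc p"
    if g: "g \<in> global_dofs T V" and g': "g' \<in> constraining_dofs R C T V g"
      and loc: "dof_owner V g \<in> proc_local_vefs R C T k proc p" for g g' p
  proof -
    obtain X G where own: "owner_wrt R C T (dof_owner V g) X G"
      "dof_owner V g' \<in> insert G (boundary_vefs X G)"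
      using g' unfolding constraining_dofs_def by blast
    then show ?thesis
      using constraint_vef_proc_local[OF loc own(1) adm[OF g] own(2)] by blast
  qed
  have "g' \<notin> hanging_dofs T V" if "g \<in> hanging_dofs T V" "g' \<in> constraining_dofs R C T V g" for g g'
    using direct[of g g'] that unfolding hanging_dofs_def hanging_vefs_def regular_vefs_def by blast
  \<comment> \<open>Every introduction rule of \<open>proc_local_vefs\<close> has this membership as
    a premise.\<close>
  moreover have "F \<in> proc_vefs T k proc p" if "F \<in> proc_local_vefs R C T k proc p" for F p
    using that by cases
  ultimately show ?thesis
    using direct proc_local unfolding hanging_dofs_def by blast
qed

end
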